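(* Let $d \geq 1$ and $n \geq 1$ be integers, and let $P_0, \ldots, P_d$ be $d+1$ pairwise disjoint finite subsets of $\mathbb{R}^d$, each containing exactly $n$ points. Then there exists a point of $\mathbb{R}^d$ that is contained in at least $$\frac{2d}{(d+1)\,(d+1)!}\cdot n^{d+1}$$ colorful simplices.
   Context: A colorful simplex is the convex hull $\mathrm{conv}(v_0,\ldots,v_d)$ of $d+1$ points, each of which comes from a distinct $P_i$, i.e. $v_i \in P_i$ for $0 \leq i \leq d$. Colorful simplices (possibly degenerate, since no general position is assumed) are counted by the choice of vertices $(v_0,\ldots,v_d) \in P_0\times\cdots\times P_d$, so there are $n^{d+1}$ of them in total; thus the number of colorful simplices containing a point $p$ is the number of tuples $(v_0,\ldots,v_d) \in P_0\times\cdots\times P_d$ with $p \in \mathrm{conv}(v_0,\ldots,v_d)$. *)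

theory Defs
  imports "HOL-Analysis.Analysis" "HOL-Library.FuncSet"
begin

text \<open>Colour classes \<open>P 0, \<dots>, P d\<close> are a family indexed by \<open>nat\<close>, of which only the
  indices \<open>{..d}\<close> matter. Vertex tuples are extensional functions, so that distinct tuples
  in the product are distinct functions and the product is finite when the classes are.\<close>

definition colorful_tuples :: "nat \<Rightarrow> (nat \<Rightarrow> 'a set) \<Rightarrow> (nat \<Rightarrow> 'a) set" where
  "colorful_tuples d P = (\<Pi>\<^sub>E i\<in>{..d}. P i)"

definition colorful_simplex :: "nat \<Rightarrow> (nat \<Rightarrow> 'a::real_vector) \<Rightarrow> 'a set" where
  "colorful_simplex d v = convex hull (v ` {..d})"

text \<open>Possibly degenerate simplices are counted by their vertex tuples, not as point sets.\<close>

definition num_colorful_simplices_containing ::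
    "nat \<Rightarrow> (nat \<Rightarrow> 'a::real_vector set) \<Rightarrow> 'a \<Rightarrow> nat" where
  "num_colorful_simplices_containing d P p =
     card {v \<in> colorful_tuples d P. p \<in> colorful_simplex d v}"

end

theory Submission
  imports Defs "HOL-Library.Z2"
begin

text \<open>Gromov's cofilling argument, in the colourful form of Karasev and Jiang, with mod 2 cochains.
  By compactness, if no point is deep then for some \<open>\<delta>\<close> even every \<open>\<delta>\<close>-ball meets too few
  colourful simplices, and the points may be moved into general position.
  To a small \<open>k\<close>-simplex \<open>\<tau>\<close> of a triangulation one attaches the set of tuples of the last
  \<open>d + 1 - k\<close> colours whose hull meets \<open>\<tau>\<close>, plus fillings of the cochains of its facets. This is
  a cocycle, and coning it from the best vertex of colour \<open>k\<close> gives a filling whose size is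
  smaller by a factor \<open>n\<close>. In the last filling, two complementary choices are possible; the smaller
  one covers less than the fraction \<open>1 / (d + 1)\<close> of the last two colours, on average. Hence the
  \<open>d + 1\<close> facets of a small \<open>d\<close>-simplex cannot cover everything, so that the
  cochain attached to it, which is constant, vanishes. Summing over a fine subdivision of a large
  simplex contradicts the fact that this simplex contains all the points.\<close>

subsection \<open>Chains modulo 2\<close>

text \<open>Origin of the constant: two sets of size \<open>N / (d + 1)\<close> in the last two
  colours differ, as cylinders, in a fraction \<open>2 d / (d + 1)^2\<close> of all pairs, and below
  this fraction their sizes add up to less than \<open>2 N / (d + 1)\<close>. Each passage from
  \<open>k\<close> to \<open>k + 1\<close> multiplies the bound by the \<open>k + 2\<close> facets
  of a \<open>(k + 1)\<close>-simplex and divides it by \<open>n\<close>; up to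
  \<open>k = d - 1\<close> the factors make \<open>d!\<close>, and dividing the threshold by
  \<open>d!\<close> gives \<open>2 d / ((d + 1) (d + 1)!)\<close>. The obstacle is that each level
  also adds the tuples whose hull meets the new simplex, and counting these separately would spoil
  the factor \<open>k + 2\<close>. Hence the bounding sets start from all tuples passing within
  \<open>\<delta>\<close> of a vertex: a small simplex lies in the \<open>\<delta>\<close>-ball
  about each of its vertices, and coning only enlarges hulls, so the new tuples are already counted.
  The large simplex depends on the moved points, so general position must be secured before the
  triangulation is known. This is done against all rational points at once, a countable set closed
  under barycentres.\<close>

declare add_bit_eq_xor [simp del]

fun faces :: "'a list \<Rightarrow> 'a list list" where
  "faces [] = []"
| "faces (x # xs) = xs # map ((#) x) (faces xs)"

text \<open>This is \<open>g\<close> on the boundary of \<open>xs\<close>, or the coboundary of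
  \<open>g\<close> at \<open>xs\<close>. Both readings occur: the first in the simplex variable, the
  second in the tuple variable. The complex is augmented, since a one-element list has the face
  \<open>[]\<close>.\<close>

definition bd :: "('a list \<Rightarrow> bit) \<Rightarrow> 'a list \<Rightarrow> bit" where
  "bd g xs = (\<Sum>\<tau>\<leftarrow>faces xs. g \<tau>)"

lemma bit_add_self [simp]: "x + x = (0::bit)"
  by (cases x) auto

lemma bit_add_self_left [simp]: "x + (x + y) = (y::bit)"
  by (simp flip: add.assoc)

lemma bit_add_eq_0_iff: "x + y = 0 \<longleftrightarrow> x = (y::bit)"
  by (cases x; cases y) auto

lemma length_faces: "\<tau> \<in> set (faces xs) \<Longrightarrow> Suc (length \<tau>) = length xs"
  by (induction xs arbitrary: \<tau>) auto

lemma length_faces_less: "\<tau> \<in> set (faces xs) \<Longrightarrow> length \<tau> < length xs"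
  using length_faces[of \<tau> xs] by simp

lemma length_faces_list [simp]: "length (faces xs) = length xs"
  by (induction xs) auto

lemma set_faces: "\<tau> \<in> set (faces xs) \<Longrightarrow> set \<tau> \<subseteq> set xs"
  by (induction xs arbitrary: \<tau>) (auto, blast)

lemma face_containing:
  assumes "x \<in> set xs" "length xs \<ge> 2"
  obtains \<tau> where "\<tau> \<in> set (faces xs)" "x \<in> set \<tau>"
proof -
  obtain a b zs where "xs = a # b # zs"
    using assms(2) by (cases xs; cases "tl xs") auto
  then show ?thesis
    using that[of "b # zs"] that[of "a # zs"] assms(1) by (cases "x = a") auto
qed

lemma distinct_face_set:
  "distinct xs \<Longrightarrow> \<tau> \<in> set (faces xs) \<Longrightarrow> \<exists>v\<in>set xs. set \<tau> = set xs - {v}"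
proof (induction xs arbitrary: \<tau>)
  case (Cons x xs)
  show ?case
  proof (cases "\<tau> = xs")
    case True
    then show ?thesis using Cons(2) by auto
  next
    case False
    then obtain \<rho> where \<rho>: "\<rho> \<in> set (faces xs)" "\<tau> = x # \<rho>"
      using Cons(3) by auto
    then obtain v where "v \<in> set xs" "set \<rho> = set xs - {v}"
      using Cons(1)[of \<rho>] Cons(2) by auto
    with \<rho> Cons(2) show ?thesis by (intro bexI[of _ v]) auto
  qed
qed auto

lemma bd_Nil [simp]: "bd g [] = 0"
  by (simp add: bd_def)

lemma bd_Cons: "bd g (x # xs) = g xs + bd (\<lambda>ys. g (x # ys)) xs"
  by (simp add: bd_def comp_def)

lemma bd_cong: "(\<And>\<tau>. \<tau> \<in> set (faces xs) \<Longrightarrow> g \<tau> = h \<tau>) \<Longrightarrow> bd g xs = bd h xs"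
  unfolding bd_def by (rule arg_cong[where f=sum_list]) auto

lemma bd_zero [simp]: "bd (\<lambda>_. 0) xs = 0"
  by (induction xs) (auto simp: bd_Cons)

lemma bd_eq_0: "(\<And>\<tau>. \<tau> \<in> set (faces xs) \<Longrightarrow> g \<tau> = 0) \<Longrightarrow> bd g xs = 0"
  using bd_cong[of xs g "\<lambda>_. 0"] by simp

lemma bd_add: "bd (\<lambda>\<tau>. g \<tau> + h \<tau>) xs = bd g xs + bd h xs"
  unfolding bd_def by (rule sum_list_addf)

lemma sum_list_swap:
  "(\<Sum>x\<leftarrow>xs. \<Sum>y\<leftarrow>ys. g x y) = (\<Sum>y\<leftarrow>ys. \<Sum>x\<leftarrow>xs. (g x y :: 'b::comm_monoid_add))"
  by (induction xs) (simp_all add: sum_list_addf)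

lemma bd_swap: "bd (\<lambda>\<tau>. bd (g \<tau>) ys) xs = bd (\<lambda>s. bd (\<lambda>\<tau>. g \<tau> s) xs) ys"
  unfolding bd_def by (rule sum_list_swap)

lemma bd_bd [simp]: "bd (bd g) xs = 0"
proof (induction xs arbitrary: g)
  case (Cons x xs)
  have "bd (bd g) (x # xs) = bd g xs + bd (\<lambda>ys. g ys + bd (\<lambda>zs. g (x # zs)) ys) xs"
    by (simp add: bd_Cons)
  also have "\<dots> = bd (bd (\<lambda>zs. g (x # zs))) xs"
    by (simp add: bd_add)
  finally show ?case using Cons by simp
qed simp

lemma bd_eq_1D: "bd g xs = 1 \<Longrightarrow> \<exists>\<tau>\<in>set (faces xs). g \<tau> = 1"
  using bd_eq_0[of xs g] by force

text \<open>A simplex is the list of its vertices and a chain modulo 2 is a list of simplices, on which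
  a cochain is evaluated by summation. \<open>sd\<close> is the barycentric subdivision for an arbitrary
  choice \<open>b\<close> of barycentres, and \<open>sdh\<close> the chain homotopy from it to the identity.\<close>

context
  fixes b :: "'a list \<Rightarrow> 'a"
begin

function sd :: "'a list \<Rightarrow> 'a list list" where
  "sd [] = [[]]"
| "sd (x # xs) = map ((#) (b (x # xs))) (concat (map sd (faces (x # xs))))"
  by pat_completeness auto
termination
  by (relation "Wellfounded.measure length") (auto dest: length_faces)

function sdh :: "'a list \<Rightarrow> 'a list list" where
  "sdh [] = []"
| "sdh (x # xs) = map ((#) (b (x # xs))) ((x # xs) # concat (map sdh (faces (x # xs))))"
  by pat_completeness auto
termination
  by (relation "Wellfounded.measure length") (auto dest: length_faces)

end

declare sd.simps [simp del] sdh.simps [simp del]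

lemma sum_list_concat_map: "(\<Sum>\<rho>\<leftarrow>concat (map h xs). g \<rho>) = (\<Sum>x\<leftarrow>xs. \<Sum>\<rho>\<leftarrow>h x. (g \<rho> :: 'b::comm_monoid_add))"
  by (induction xs) auto

lemma sd_eval: "xs \<noteq> [] \<Longrightarrow> 
   (\<Sum>\<rho>\<leftarrow>sd b xs. g \<rho>) = bd (\<lambda>\<tau>. \<Sum>\<rho>\<leftarrow>sd b \<tau>. g (b xs # \<rho>)) xs"
  by (cases xs) (simp_all only: sd.simps bd_def map_map comp_def sum_list_concat_map simp_thms)

lemma sdh_eval: "xs \<noteq> [] \<Longrightarrow> 
   (\<Sum>\<rho>\<leftarrow>sdh b xs. g \<rho>) = g (b xs # xs) + bd (\<lambda>\<tau>. \<Sum>\<rho>\<leftarrow>sdh b \<tau>. g (b xs # \<rho>)) xs"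
  by (cases xs) (simp_all only: sdh.simps bd_def list.map sum_list.Cons map_map comp_def sum_list_concat_map simp_thms)

lemma in_sd_iff: "xs \<noteq> [] \<Longrightarrow>
    \<rho> \<in> set (sd b xs) \<longleftrightarrow> (\<exists>\<tau>\<in>set (faces xs). \<exists>\<rho>'\<in>set (sd b \<tau>). \<rho> = b xs # \<rho>')"
  by (cases xs) (auto simp: sd.simps simp del: faces.simps)

lemma in_sdh_iff: "xs \<noteq> [] \<Longrightarrow>
    \<rho> \<in> set (sdh b xs) \<longleftrightarrow>
      \<rho> = b xs # xs \<or> (\<exists>\<tau>\<in>set (faces xs). \<exists>\<rho>'\<in>set (sdh b \<tau>). \<rho> = b xs # \<rho>')"
  by (cases xs) (auto simp: sdh.simps simp del: faces.simps)

text \<open>The boundary of a cone is its base plus the cone over the boundary of the base. By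
  induction the latter comes from faces of faces, which cancel in pairs by
  \<open>bd_bd\<close>.\<close>

lemma sd_chain_map:
  "(\<Sum>\<rho>\<leftarrow>sd b xs. bd g \<rho>) = bd (\<lambda>\<tau>. \<Sum>\<rho>\<leftarrow>sd b \<tau>. g \<rho>) xs"
proof (induction "length xs" arbitrary: xs g rule: less_induct)
  case less
  show ?case
  proof (cases "xs = []")
    case True
    then show ?thesis by (simp add: sd.simps)
  next
    case False
    let ?h = "\<lambda>\<rho>. g (b xs # \<rho>)"
    have "(\<Sum>\<rho>\<leftarrow>sd b xs. bd g \<rho>) = bd (\<lambda>\<tau>. (\<Sum>\<rho>\<leftarrow>sd b \<tau>. g \<rho>) + (\<Sum>\<rho>\<leftarrow>sd b \<tau>. bd ?h \<rho>)) xs"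
      by (simp add: sd_eval[OF False] bd_Cons sum_list_addf)
    also have "\<dots> = bd (\<lambda>\<tau>. (\<Sum>\<rho>\<leftarrow>sd b \<tau>. g \<rho>) + bd (\<lambda>\<tau>. \<Sum>\<rho>\<leftarrow>sd b \<tau>. ?h \<rho>) \<tau>) xs"
      by (intro bd_cong arg_cong2[where f="(+)"] less length_faces_less refl)
    finally show ?thesis by (simp add: bd_add)
  qed
qed

text \<open>The same cone computation: the term \<open>bd ?h xs\<close> arises once from the cone
  over \<open>xs\<close> itself and once from the induction hypothesis on the facets, and
  cancels.\<close>

lemma sdh_homotopy:
  "(\<Sum>\<rho>\<leftarrow>sdh b xs. bd g \<rho>) =
     g xs + (\<Sum>\<rho>\<leftarrow>sd b xs. g \<rho>) + bd (\<lambda>\<tau>. \<Sum>\<rho>\<leftarrow>sdh b \<tau>. g \<rho>) xs"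
proof (induction "length xs" arbitrary: xs g rule: less_induct)
  case less
  show ?case
  proof (cases "xs = []")
    case True
    then show ?thesis by (simp add: sd.simps sdh.simps)
  next
    case False
    let ?h = "\<lambda>\<rho>. g (b xs # \<rho>)"
    have "bd (\<lambda>\<tau>. \<Sum>\<rho>\<leftarrow>sdh b \<tau>. bd ?h \<rho>) xs
      = bd (\<lambda>\<tau>. ?h \<tau> + (\<Sum>\<rho>\<leftarrow>sd b \<tau>. ?h \<rho>) + bd (\<lambda>\<tau>. \<Sum>\<rho>\<leftarrow>sdh b \<tau>. ?h \<rho>) \<tau>) xs"
      by (intro bd_cong arg_cong2[where f="(+)"] less length_faces_less refl)
    also have "\<dots> = bd ?h xs + (\<Sum>\<rho>\<leftarrow>sd b xs. g \<rho>)"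
      by (simp add: bd_add sd_eval[OF False])
    finally show ?thesis
      by (simp add: sdh_eval[OF False] bd_Cons sum_list_addf bd_add ac_simps)
  qed
qed

lemma length_sd: "\<rho> \<in> set (sd b xs) \<Longrightarrow> length \<rho> = length xs"
proof (induction "length xs" arbitrary: xs \<rho> rule: less_induct)
  case less
  show ?case
  proof (cases "xs = []")
    case True
    with less.prems show ?thesis by (simp add: sd.simps)
  next
    case False
    with less.prems obtain \<tau> \<rho>'
      where *: "\<tau> \<in> set (faces xs)" "\<rho>' \<in> set (sd b \<tau>)" "\<rho> = b xs # \<rho>'"
      by (auto simp: in_sd_iff[OF False])
    then show ?thesis
      using less(1)[OF length_faces_less[OF *(1)] *(2)] length_faces[OF *(1)] by simp
  qed
qed

lemma length_sdh: "\<rho> \<in> set (sdh b xs) \<Longrightarrow> length \<rho> = Suc (length xs)"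
proof (induction "length xs" arbitrary: xs \<rho> rule: less_induct)
  case less
  show ?case
  proof (cases "xs = []")
    case True
    with less.prems show ?thesis by (simp add: sdh.simps)
  next
    case False
    with less.prems consider "\<rho> = b xs # xs" |
      \<tau> \<rho>' where "\<tau> \<in> set (faces xs)" "\<rho>' \<in> set (sdh b \<tau>)" "\<rho> = b xs # \<rho>'"
      by (auto simp: in_sdh_iff[OF False])
    then show ?thesis
    proof cases
      case 2
      then show ?thesis
        using less(1)[OF length_faces_less[OF 2(1)] 2(2)] length_faces[OF 2(1)] by simp
    qed simp
  qed
qed

text \<open>\<open>S\<close> will be a convex hull, to localise the subdivision, or the countable
  set of admissible vertices.\<close>

lemma set_sd:
  assumes "\<And>ys. ys \<noteq> [] \<Longrightarrow> set ys \<subseteq> S \<Longrightarrow> b ys \<in> S"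
  shows "set xs \<subseteq> S \<Longrightarrow> \<rho> \<in> set (sd b xs) \<Longrightarrow> set \<rho> \<subseteq> S"
proof (induction "length xs" arbitrary: xs \<rho> rule: less_induct)
  case less
  show ?case
  proof (cases "xs = []")
    case True
    with less.prems show ?thesis by (simp add: sd.simps)
  next
    case False
    with less(3) obtain \<tau> \<rho>' where *: "\<tau> \<in> set (faces xs)" "\<rho>' \<in> set (sd b \<tau>)" "\<rho> = b xs # \<rho>'"
      by (auto simp: in_sd_iff[OF False])
    moreover have "set \<tau> \<subseteq> S" "length \<tau> < length xs"
      using *(1) length_faces_less set_faces[OF *(1)] less(2) by blast+
    ultimately show ?thesis using less(1)[of \<tau> \<rho>'] assms[of xs] less(2) False by simp
  qed
qed

lemma set_sdh:
  assumes "\<And>ys. ys \<noteq> [] \<Longrightarrow> set ys \<subseteq> S \<Longrightarrow> b ys \<in> S"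
  shows "set xs \<subseteq> S \<Longrightarrow> \<rho> \<in> set (sdh b xs) \<Longrightarrow> set \<rho> \<subseteq> S"
proof (induction "length xs" arbitrary: xs \<rho> rule: less_induct)
  case less
  show ?case
  proof (cases "xs = []")
    case True
    with less.prems show ?thesis by (simp add: sdh.simps)
  next
    case False
    have b: "b xs \<in> S" using assms[of xs] less(2) False by simp
    from less(3) consider "\<rho> = b xs # xs" |
      \<tau> \<rho>' where "\<tau> \<in> set (faces xs)" "\<rho>' \<in> set (sdh b \<tau>)" "\<rho> = b xs # \<rho>'"
      by (auto simp: in_sdh_iff[OF False])
    then show ?thesis
    proof cases
      case 1
      then show ?thesis using b less(2) by auto
    next
      case 2
      then have "set \<rho>' \<subseteq> S"
        using less(1)[OF length_faces_less[OF 2(1)]] set_faces[OF 2(1)] less(2) by blast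
      then show ?thesis using b 2 by auto
    qed
  qed
qed

fun sdn :: "('a list \<Rightarrow> 'a) \<Rightarrow> nat \<Rightarrow> 'a list \<Rightarrow> 'a list list" where
  "sdn b 0 xs = [xs]"
| "sdn b (Suc m) xs = concat (map (sd b) (sdn b m xs))"

lemma sdn_chain_map:
  "(\<Sum>\<rho>\<leftarrow>sdn b m xs. bd g \<rho>) = bd (\<lambda>\<tau>. \<Sum>\<rho>\<leftarrow>sdn b m \<tau>. g \<rho>) xs"
  by (induction m arbitrary: g) (simp_all add: sum_list_concat_map sd_chain_map)

lemma length_sdn: "\<rho> \<in> set (sdn b m xs) \<Longrightarrow> length \<rho> = length xs"
  by (induction m arbitrary: \<rho>) (auto dest: length_sd)

lemma set_sdn:
  assumes "\<And>ys. ys \<noteq> [] \<Longrightarrow> set ys \<subseteq> S \<Longrightarrow> b ys \<in> S"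
  shows "set xs \<subseteq> S \<Longrightarrow> \<rho> \<in> set (sdn b m xs) \<Longrightarrow> set \<rho> \<subseteq> S"
proof (induction m arbitrary: \<rho>)
  case (Suc m)
  then obtain \<sigma> where "\<sigma> \<in> set (sdn b m xs)" "\<rho> \<in> set (sd b \<sigma>)" by auto
  with Suc.IH[of \<sigma>] Suc.prems(1) set_sd[of S b \<sigma> \<rho>, OF assms] show ?case by blast
qed simp

subsection \<open>Intersections in general position\<close>

text \<open>The ratio test of the simplex method: \<open>t\<close> is the least
  \<open>u i / (- w i)\<close> over the decreasing coordinates.\<close>

lemma exists_first_zero:
  fixes u w :: "'i \<Rightarrow> real"
  assumes "finite I" "\<And>i. i \<in> I \<Longrightarrow> u i \<ge> 0" "\<exists>i\<in>I. w i < 0"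
  obtains t j where "t \<ge> 0" "j \<in> I" "w j < 0" "u j + t * w j = 0" "\<And>i. i \<in> I \<Longrightarrow> u i + t * w i \<ge> 0"
proof -
  let ?N = "{i \<in> I. w i < 0}" and ?r = "\<lambda>i. u i / (- w i)"
  have N: "finite ?N" "?N \<noteq> {}" using assms by auto
  define t where "t = Min (?r ` ?N)"
  have "t \<in> ?r ` ?N" unfolding t_def using N by (intro Min_in) auto
  then obtain j where j: "j \<in> ?N" "t = ?r j" by auto
  have le: "t \<le> ?r i" if "i \<in> ?N" for i
    unfolding t_def using N that by (intro Min_le) auto
  have t0: "t \<ge> 0" using j assms(2)[of j] by (simp add: divide_nonneg_neg)
  show ?thesis
  proof (rule that[of t j])
    show "u j + t * w j = 0" using j by (simp add: field_simps)
    fix i assume i: "i \<in> I"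
    show "u i + t * w i \<ge> 0"
    proof (cases "w i < 0")
      case True
      with le[of i] i show ?thesis by (simp add: field_simps)
    next
      case False
      with assms(2)[OF i] t0 show ?thesis by simp
    qed
  qed (use j t0 in auto)
qed

text \<open>The hypotheses say that \<open>P\<close> is the intersection of the nonnegative orthant with an affine
  space of direction \<open>W\<close>, that it is bounded, and that no point of it lies on two facets.
  Hence it is a segment if it touches a facet at all.\<close>

lemma even_card_touched_facets:
  fixes P W :: "('i \<Rightarrow> real) set"
  assumes fin: "finite I"
    and nonneg: "\<And>u i. u \<in> P \<Longrightarrow> i \<in> I \<Longrightarrow> u i \<ge> 0"
    and move: "\<And>u w t. u \<in> P \<Longrightarrow> w \<in> W \<Longrightarrow> \<forall>i\<in>I. u i + t * w i \<ge> 0 \<Longrightarrow> (\<lambda>i. u i + t * w i) \<in> P"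
    and diff: "\<And>u v. u \<in> P \<Longrightarrow> v \<in> P \<Longrightarrow> (\<lambda>i. u i - v i) \<in> W"
    and comb: "\<And>v w a b. v \<in> W \<Longrightarrow> w \<in> W \<Longrightarrow> (\<lambda>i. a * v i + b * w i) \<in> W"
    and neg: "\<And>w i. w \<in> W \<Longrightarrow> i \<in> I \<Longrightarrow> w i \<noteq> 0 \<Longrightarrow> \<exists>j\<in>I. w j < 0"
    and nontriv: "\<exists>w\<in>W. \<exists>i\<in>I. w i \<noteq> 0"
    and one_zero: "\<And>u i j. u \<in> P \<Longrightarrow> i \<in> I \<Longrightarrow> j \<in> I \<Longrightarrow> u i = 0 \<Longrightarrow> u j = 0 \<Longrightarrow> i = j"
  shows "even (card {i \<in> I. \<exists>u\<in>P. u i = 0})"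
proof (cases "{i \<in> I. \<exists>u\<in>P. u i = 0} = {}")
  case False
  have first: "\<exists>t j. t \<ge> 0 \<and> j \<in> I \<and> w j < 0 \<and> u j + t * w j = 0 \<and> (\<lambda>i. u i + t * w i) \<in> P"
    if "u \<in> P" "w \<in> W" "i \<in> I" "w i \<noteq> 0" for u w i
  proof -
    note uw = that
    obtain t j where "t \<ge> 0" "j \<in> I" "w j < 0" "u j + t * w j = 0" "\<And>i. i \<in> I \<Longrightarrow> u i + t * w i \<ge> 0"
      by (rule exists_first_zero[OF fin nonneg[OF uw(1)] neg[OF uw(2-4)]]) auto
    with move[OF uw(1,2)] show ?thesis by blast
  qed
  \<comment> \<open>Moving along \<open>w\<close> would keep coordinate \<open>i\<close> at zero and
    bring a second coordinate to zero. So on \<open>I\<close> a direction is determined by its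
    coordinate \<open>i\<close>, and the directions form at most a line.\<close>
  have zero: "w k = 0" if "u \<in> P" "i \<in> I" "u i = 0" "w \<in> W" "w i = 0" "k \<in> I" for u w i k
  proof (rule ccontr)
    assume "w k \<noteq> 0"
    from first[OF that(1,4,6) this] obtain t j
      where "j \<in> I" "w j < 0" "u j + t * w j = 0" "(\<lambda>i. u i + t * w i) \<in> P" by blast
    with one_zero[of "\<lambda>i. u i + t * w i" i j] that show False by auto
  qed
  from False obtain i u where i: "i \<in> I" "u \<in> P" "u i = 0" by auto
  obtain w0 k0 where w0: "w0 \<in> W" "k0 \<in> I" "w0 k0 \<noteq> 0" using nontriv by blast
  have w0i: "w0 i \<noteq> 0" using zero[OF i(2,1,3) w0(1) _ w0(2)] w0(3) by blast
  define w where "w = (\<lambda>k. sgn (w0 i) * w0 k)"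
  have w: "w \<in> W" "w i > 0"
    using comb[OF w0(1) w0(1), of "sgn (w0 i)" 0] w0i
    by (auto simp: w_def abs_sgn mult.commute simp flip: abs_sgn)
  obtain t j where j: "t \<ge> 0" "j \<in> I" "w j < 0" "u j + t * w j = 0" "(\<lambda>i. u i + t * w i) \<in> P"
    using first[OF i(2) w(1) i(1)] w(2) by auto
  have "j \<noteq> i" using j(3) w(2) by auto
  have "{i \<in> I. \<exists>u\<in>P. u i = 0} = {i, j}"
  proof (intro equalityI subsetI)
    fix k assume "k \<in> {i \<in> I. \<exists>u\<in>P. u i = 0}"
    then obtain x where k: "k \<in> I" "x \<in> P" "x k = 0" by auto
    show "k \<in> {i, j}"
    proof (rule ccontr)
      assume kij: "k \<notin> {i, j}"
      have pos: "x i > 0" "x j > 0" "u k > 0"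
        using one_zero[OF k(2) k(1) i(1)] one_zero[OF k(2) k(1) j(2)] one_zero[OF i(2,1) k(1)]
          nonneg[OF k(2) i(1)] nonneg[OF k(2) j(2)] nonneg[OF i(2) k(1)] k(3) i(3) kij
        by force+
      \<comment> \<open>By \<open>zero\<close>, \<open>x\<close> is the point with parameter
        \<open>c\<close> on the line through \<open>u\<close>. It lies strictly before the end
        \<open>t\<close>, yet coordinate \<open>k\<close> has already dropped to zero there, so it
        would be negative at \<open>t\<close>.\<close>
      define c where "c = x i / w i"
      have x: "x l = u l + c * w l" if "l \<in> I" for l
        using zero[OF i(2,1,3) comb[OF diff[OF k(2) i(2)] w(1), of 1 "-c"] _ that] w(2) i(3)
        by (simp add: c_def)
      have "c * w j > t * w j" using x[OF j(2)] pos(2) j(4) by simp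
      then have ct: "c < t" using j(3) by simp
      have c0: "c > 0" using pos(1) w(2) by (simp add: c_def)
      have "c * w k < 0" using x[OF k(1)] k(3) pos(3) by simp
      then have "w k < 0" using c0 by (simp add: mult_less_0_iff)
      then have "t * w k < c * w k" using ct by simp
      then have "u k + t * w k < 0" using x[OF k(1)] k(3) by simp
      with nonneg[OF j(5) k(1)] show False by simp
    qed
  qed (use i j in auto)
  then show ?thesis using \<open>j \<noteq> i\<close> by simp
qed (simp only: card.empty even_zero)

text \<open>The coefficients belong to indices, not points, because \<open>h\<close> need not be
  injective.\<close>

lemma convex_hull_image_iff:
  fixes h :: "'i \<Rightarrow> 'a::real_vector"
  assumes "finite I"
  shows "y \<in> convex hull (h ` I) \<longleftrightarrow>
    (\<exists>\<alpha>. (\<forall>i\<in>I. \<alpha> i \<ge> 0) \<and> sum \<alpha> I = 1 \<and> (\<Sum>i\<in>I. \<alpha> i *\<^sub>R h i) = y)"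
proof
  let ?S = "{y. \<exists>\<alpha>. (\<forall>i\<in>I. \<alpha> i \<ge> 0) \<and> sum \<alpha> I = 1 \<and> (\<Sum>i\<in>I. \<alpha> i *\<^sub>R h i) = y}"
  have "convex ?S"
  proof (rule convexI)
    fix x y and s t :: real
    assume "x \<in> ?S" "y \<in> ?S" and st: "0 \<le> s" "0 \<le> t" "s + t = 1"
    then obtain \<alpha> \<beta> where "\<forall>i\<in>I. \<alpha> i \<ge> 0" "sum \<alpha> I = 1" "(\<Sum>i\<in>I. \<alpha> i *\<^sub>R h i) = x"
      "\<forall>i\<in>I. \<beta> i \<ge> 0" "sum \<beta> I = 1" "(\<Sum>i\<in>I. \<beta> i *\<^sub>R h i) = y" by blast
    with st show "s *\<^sub>R x + t *\<^sub>R y \<in> ?S"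
      by (intro CollectI exI[of _ "\<lambda>i. s * \<alpha> i + t * \<beta> i"])
         (auto simp: sum.distrib scaleR_add_left scaleR_right.sum simp flip: sum_distrib_left)
  qed
  moreover have "h ` I \<subseteq> ?S"
  proof safe
    fix i assume "i \<in> I"
    with assms have "(\<Sum>k\<in>I. of_bool (k = i) *\<^sub>R h k) = h i" "(\<Sum>k\<in>I. of_bool (k = i)) = (1::real)"
      by (auto simp: of_bool_def if_distrib[of "\<lambda>c. c *\<^sub>R _"] cong: if_cong)
    then show "\<exists>\<alpha>. (\<forall>i\<in>I. \<alpha> i \<ge> 0) \<and> sum \<alpha> I = 1 \<and> (\<Sum>i\<in>I. \<alpha> i *\<^sub>R h i) = h i"
      by (intro exI[of _ "\<lambda>k. of_bool (k = i)"]) simp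
  qed
  ultimately have "convex hull (h ` I) \<subseteq> ?S" by (intro hull_minimal)
  then show "y \<in> convex hull (h ` I) \<Longrightarrow> \<exists>\<alpha>. (\<forall>i\<in>I. \<alpha> i \<ge> 0) \<and> sum \<alpha> I = 1 \<and> (\<Sum>i\<in>I. \<alpha> i *\<^sub>R h i) = y"
    by blast
next
  assume "\<exists>\<alpha>. (\<forall>i\<in>I. \<alpha> i \<ge> 0) \<and> sum \<alpha> I = 1 \<and> (\<Sum>i\<in>I. \<alpha> i *\<^sub>R h i) = y"
  then obtain \<alpha> where "\<forall>i\<in>I. \<alpha> i \<ge> 0" "sum \<alpha> I = 1" "(\<Sum>i\<in>I. \<alpha> i *\<^sub>R h i) = y" by blast
  moreover from this have "(\<Sum>i\<in>I. \<alpha> i *\<^sub>R h i) \<in> convex hull (h ` I)"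
    by (intro convex_sum[OF assms convex_convex_hull]) (auto intro: hull_inc)
  ultimately show "y \<in> convex hull (h ` I)" by simp
qed

text \<open>A repeated vector is already a dependence between two indices; only injective families
  need the dimension.\<close>

lemma exists_linear_dependence:
  fixes h :: "'i \<Rightarrow> 'a::euclidean_space"
  assumes "finite I" "card I > DIM('a)"
  shows "\<exists>w. (\<exists>i\<in>I. w i \<noteq> 0) \<and> (\<Sum>i\<in>I. w i *\<^sub>R h i) = 0"
proof (cases "inj_on h I")
  case True
  then have "dependent (h ` I)"
    using assms by (intro dependent_biggerset) (auto simp: card_image)
  then obtain u where "(\<Sum>v\<in>h ` I. u v *\<^sub>R v) = 0" "\<exists>v\<in>h ` I. u v \<noteq> 0"
    using assms(1) by (auto simp: dependent_finite)
  then show ?thesis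
    using True by (intro exI[of _ "u \<circ> h"]) (auto simp: sum.reindex)
next
  case False
  then obtain i j where ij: "i \<in> I" "j \<in> I" "i \<noteq> j" "h i = h j" by (auto simp: inj_on_def)
  define w where "w = (\<lambda>k. of_bool (k = i) - of_bool (k = j) :: real)"
  have "(\<Sum>k\<in>I. w k *\<^sub>R h k) = h i - h j"
    using assms(1) ij by (simp add: w_def scaleR_diff_left sum_subtractf of_bool_def if_distrib[of "\<lambda>c. c *\<^sub>R _"] cong: if_cong)
  then show ?thesis using ij by (intro exI[of _ w]) (auto simp: w_def)
qed

text \<open>A common point of the two hulls is a pair of barycentric coordinate vectors, merged into
  one function \<open>u\<close>. These form a polytope \<open>P\<close> given by
  \<open>DIM('a) + 2\<close> linear equations in \<open>DIM('a) + 3\<close> unknowns, and deleting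
  vertex \<open>i\<close> means \<open>u i = 0\<close>.\<close>

lemma even_card_facet_meets:
  fixes h :: "'i \<Rightarrow> 'a::euclidean_space"
  assumes fin: "finite A" "finite B" and disj: "A \<inter> B = {}"
    and card: "card A + card B = DIM('a) + 3"
    and gen: "\<And>A' B'. A' \<subseteq> A \<Longrightarrow> B' \<subseteq> B \<Longrightarrow> card A' + card B' \<le> DIM('a) + 1 \<Longrightarrow>
                 convex hull (h ` A') \<inter> convex hull (h ` B') = {}"
  shows "even (card {i \<in> A \<union> B. convex hull (h ` (A - {i})) \<inter> convex hull (h ` (B - {i})) \<noteq> {}})"
proof -
  let ?I = "A \<union> B"
  define L where "L = (\<lambda>u :: 'i \<Rightarrow> real. (\<Sum>i\<in>A. u i *\<^sub>R h i) - (\<Sum>i\<in>B. u i *\<^sub>R h i))"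
  define P where "P = {u. (\<forall>i\<in>?I. u i \<ge> 0) \<and> sum u A = 1 \<and> sum u B = 1 \<and> L u = 0}"
  define W where "W = {w :: 'i \<Rightarrow> real. sum w A = 0 \<and> sum w B = 0 \<and> L w = 0}"
  have meet: "convex hull (h ` (A - Z)) \<inter> convex hull (h ` (B - Z)) \<noteq> {} \<longleftrightarrow>
                 (\<exists>u\<in>P. \<forall>i\<in>Z. u i = 0)" if "Z \<subseteq> ?I" for Z
  proof
    assume "convex hull (h ` (A - Z)) \<inter> convex hull (h ` (B - Z)) \<noteq> {}"
    then obtain y where "y \<in> convex hull (h ` (A - Z))" "y \<in> convex hull (h ` (B - Z))" by blast
    then obtain \<alpha> \<beta> where \<alpha>: "\<forall>i\<in>A - Z. \<alpha> i \<ge> 0" "sum \<alpha> (A - Z) = 1" "(\<Sum>i\<in>A - Z. \<alpha> i *\<^sub>R h i) = y"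
      and \<beta>: "\<forall>i\<in>B - Z. \<beta> i \<ge> 0" "sum \<beta> (B - Z) = 1" "(\<Sum>i\<in>B - Z. \<beta> i *\<^sub>R h i) = y"
      using fin by (auto simp: convex_hull_image_iff)
    define u where "u = (\<lambda>i. if i \<in> Z then 0 else if i \<in> A then \<alpha> i else \<beta> i)"
    have "sum u A = sum \<alpha> (A - Z)" "sum u B = sum \<beta> (B - Z)"
      "(\<Sum>i\<in>A. u i *\<^sub>R h i) = (\<Sum>i\<in>A - Z. \<alpha> i *\<^sub>R h i)" "(\<Sum>i\<in>B. u i *\<^sub>R h i) = (\<Sum>i\<in>B - Z. \<beta> i *\<^sub>R h i)"
      using fin disj by (auto intro!: sum.mono_neutral_cong_right simp: u_def)
    then have "u \<in> P" using \<alpha> \<beta> by (auto simp: P_def L_def u_def)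
    then show "\<exists>u\<in>P. \<forall>i\<in>Z. u i = 0" by (intro bexI[of _ u]) (auto simp: u_def)
  next
    assume "\<exists>u\<in>P. \<forall>i\<in>Z. u i = 0"
    then obtain u where u: "u \<in> P" "\<forall>i\<in>Z. u i = 0" by blast
    have "sum u (A - Z) = sum u A" "sum u (B - Z) = sum u B"
      "(\<Sum>i\<in>A - Z. u i *\<^sub>R h i) = (\<Sum>i\<in>A. u i *\<^sub>R h i)" "(\<Sum>i\<in>B - Z. u i *\<^sub>R h i) = (\<Sum>i\<in>B. u i *\<^sub>R h i)"
      using fin u by (auto intro!: sum.mono_neutral_left)
    then have "(\<Sum>i\<in>A. u i *\<^sub>R h i) \<in> convex hull (h ` (A - Z))"
      "(\<Sum>i\<in>A. u i *\<^sub>R h i) \<in> convex hull (h ` (B - Z))"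
      using u fin by (auto simp: convex_hull_image_iff P_def L_def intro!: exI[of _ u])
    then show "convex hull (h ` (A - Z)) \<inter> convex hull (h ` (B - Z)) \<noteq> {}" by blast
  qed
  have "even (card {i \<in> ?I. \<exists>u\<in>P. u i = 0})"
  proof (rule even_card_touched_facets[where W = W])
    fix u w t assume *: "u \<in> P" "w \<in> W" "\<forall>i\<in>?I. u i + t * w i \<ge> 0"
    have "L (\<lambda>i. u i + t * w i) = L u + t *\<^sub>R L w"
      by (simp add: L_def scaleR_add_left sum.distrib scaleR_right.sum scaleR_diff_right)
    then show "(\<lambda>i. u i + t * w i) \<in> P"
      using * by (auto simp: P_def W_def sum.distrib simp flip: sum_distrib_left)
  next
    fix u v assume "u \<in> P" "v \<in> P"
    moreover have "L (\<lambda>i. u i - v i) = L u - L v"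
      by (simp add: L_def scaleR_diff_left sum_subtractf)
    ultimately show "(\<lambda>i. u i - v i) \<in> W" by (auto simp: P_def W_def sum_subtractf)
  next
    fix v w and a b :: real assume *: "v \<in> W" "w \<in> W"
    have "L (\<lambda>i. a * v i + b * w i) = a *\<^sub>R L v + b *\<^sub>R L w"
      by (simp add: L_def scaleR_add_left sum.distrib scaleR_right.sum scaleR_diff_right)
    then show "(\<lambda>i. a * v i + b * w i) \<in> W"
      using * by (auto simp: W_def sum.distrib simp flip: sum_distrib_left)
  next
    fix w i assume *: "w \<in> W" "i \<in> ?I" "w i \<noteq> 0"
    show "\<exists>j\<in>?I. w j < 0"
    proof (rule ccontr)
      assume "\<not> (\<exists>j\<in>?I. w j < 0)"
      then have "\<forall>j\<in>A. w j = 0" "\<forall>j\<in>B. w j = 0"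
        using *(1) sum_nonneg_eq_0_iff[OF fin(1), of w] sum_nonneg_eq_0_iff[OF fin(2), of w]
        by (auto simp: W_def not_less)
      with *(2,3) show False by auto
    qed
  next
    \<comment> \<open>The components encode the three conditions in \<open>W\<close>: equality of
      the two combinations, and coefficient sum zero over \<open>A\<close> and over
      \<open>B\<close>.\<close>
    define v where "v = (\<lambda>i. ((if i \<in> A then 1 else -1) *\<^sub>R h i, of_bool (i \<in> A) :: real, of_bool (i \<in> B) :: real))"
    have "card ?I > DIM('a \<times> real \<times> real)"
      using card card_Un_disjoint[OF fin disj] by simp
    then obtain w where w: "\<exists>i\<in>?I. w i \<noteq> 0" "(\<Sum>i\<in>?I. w i *\<^sub>R v i) = 0"
      using exists_linear_dependence[of ?I v] fin by blast
    have split: "(\<Sum>i\<in>?I. g i) = (\<Sum>i\<in>A. g i) + (\<Sum>i\<in>B. g i)" for g :: "'i \<Rightarrow> 'b::comm_monoid_add"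
      using fin disj by (rule sum.union_disjoint)
    have "i \<notin> A" if "i \<in> B" for i using that disj by auto
    then have A: "(\<Sum>i\<in>A. w i *\<^sub>R v i) = (\<Sum>i\<in>A. (w i *\<^sub>R h i, w i, 0))"
      and B: "(\<Sum>i\<in>B. w i *\<^sub>R v i) = (\<Sum>i\<in>B. (- w i *\<^sub>R h i, 0, w i))"
      using disj by (auto simp: v_def intro!: sum.cong)
    have prod: "(\<Sum>i\<in>S. (f i, g i)) = (sum f S, sum g S)" for f :: "'i \<Rightarrow> 'b::comm_monoid_add" and g :: "'i \<Rightarrow> 'c::comm_monoid_add" and S
      by (auto simp: prod_eq_iff fst_sum snd_sum)
    have "w \<in> W" using w(2)
      by (simp add: split A B prod W_def L_def sum_negf zero_prod_def)
    then show "\<exists>w\<in>W. \<exists>i\<in>?I. w i \<noteq> 0" using w(1) by blast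
  next
    fix u i j assume u: "u \<in> P" "i \<in> ?I" "j \<in> ?I" "u i = 0" "u j = 0"
    show "i = j"
    proof (rule ccontr)
      assume "i \<noteq> j"
      \<comment> \<open>Two zeros leave \<open>DIM('a) + 1\<close> vertices, few enough for
        \<open>gen\<close>.\<close>
      have "card (A - {i,j}) + card (B - {i,j}) = card (?I - {i,j})"
        using fin disj by (subst card_Un_disjoint[symmetric]) (auto simp: Un_Diff)
      also have "\<dots> = DIM('a) + 1"
        using u(2,3) fin card card_Un_disjoint[OF fin disj] \<open>i \<noteq> j\<close> by (subst card_Diff_subset) auto
      finally have "convex hull (h ` (A - {i,j})) \<inter> convex hull (h ` (B - {i,j})) = {}"
        by (intro gen) auto
      with meet[of "{i,j}"] u show False by auto
    qed
  qed (use fin in \<open>auto simp: P_def\<close>)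
  also have "{i \<in> ?I. \<exists>u\<in>P. u i = 0} =
      {i \<in> ?I. convex hull (h ` (A - {i})) \<inter> convex hull (h ` (B - {i})) \<noteq> {}}"
    using meet[of "{i}" for i] by (intro Collect_cong conj_cong refl) simp
  finally show ?thesis .
qed

section \<open>From parity of facets to an identity between cochains\<close>

lemma bd_eq_sum: "bd g xs = (\<Sum>i<length xs. g (take i xs @ drop (Suc i) xs))"
proof (induction xs arbitrary: g)
  case (Cons x xs)
  then show ?case by (simp add: bd_Cons sum.lessThan_Suc_shift del: sum.lessThan_Suc)
qed simp

lemma bd_map: "bd g (map f xs) = bd (\<lambda>ys. g (map f ys)) xs"
  by (induction xs arbitrary: g) (simp_all add: bd_Cons)

lemma set_remove_nth:
  "set (take i xs @ drop (Suc i) xs) = (!) xs ` ({..<length xs} - {i})"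
proof -
  have "set (take i xs) = (!) xs ` ({..<length xs} \<inter> {..<i})"
    by (force simp: in_set_conv_nth)
  moreover have "set (drop (Suc i) xs) = (!) xs ` ({..<length xs} \<inter> {i<..})"
  proof (intro equalityI subsetI)
    fix y assume "y \<in> set (drop (Suc i) xs)"
    then obtain k where "k < length xs - Suc i" "y = xs ! (Suc i + k)"
      by (auto simp: in_set_conv_nth)
    then show "y \<in> (!) xs ` ({..<length xs} \<inter> {i<..})"
      by (intro image_eqI[of _ _ "Suc i + k"]) auto
  next
    fix y assume "y \<in> (!) xs ` ({..<length xs} \<inter> {i<..})"
    then obtain k where "k < length xs" "i < k" "y = xs ! k" by auto
    then show "y \<in> set (drop (Suc i) xs)"
      by (auto simp: in_set_conv_nth intro!: exI[of _ "k - Suc i"])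
  qed
  moreover have "{..<length xs} - {i} = ({..<length xs} \<inter> {..<i}) \<union> ({..<length xs} \<inter> {i<..})"
    by auto
  ultimately show ?thesis by (simp add: image_Un)
qed

text \<open>An empty list has empty hull, so the augmented face \<open>[]\<close> contributes 0 to
  every boundary of \<open>meet\<close>.\<close>

definition meet :: "'a::real_vector list \<Rightarrow> 'a list \<Rightarrow> bit" where
  "meet \<sigma> s = of_bool (convex hull (set \<sigma>) \<inter> convex hull (set s) \<noteq> {})"

lemma sum_of_bool_bit: "finite I \<Longrightarrow> (\<Sum>i\<in>I. of_bool (p i)) = (of_bool (odd (card {i \<in> I. p i})) :: bit)"
proof (induction I rule: finite_induct)
  case (insert x I)
  have "{i \<in> insert x I. p i} = (if p x then insert x {i \<in> I. p i} else {i \<in> I. p i})" by auto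
  with insert show ?case by (auto simp: of_bool_def)
qed simp

text \<open>The common points of a \<open>k\<close>-simplex and an \<open>l\<close>-simplex in general position in dimension
  \<open>k + l - 1\<close> form a segment, whose two ends lie on a facet of either simplex.\<close>

lemma meet_parity:
  fixes \<sigma> s :: "'a::euclidean_space list"
  assumes len: "length \<sigma> + length s = DIM('a) + 3"
    and gen: "\<And>I J. I \<subseteq> {..<length \<sigma>} \<Longrightarrow> J \<subseteq> {..<length s} \<Longrightarrow> card I + card J \<le> DIM('a) + 1 \<Longrightarrow>
                 convex hull ((!) \<sigma> ` I) \<inter> convex hull ((!) s ` J) = {}"
  shows "bd (meet \<sigma>) s + bd (\<lambda>\<tau>. meet \<tau> s) \<sigma> = 0"
proof -
  \<comment> \<open>Positions, not points, index the facets; the disjoint sum keeps them apart even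
    if vertices are repeated.\<close>
  define A :: "(nat + nat) set" where "A = Inl ` {..<length \<sigma>}"
  define B :: "(nat + nat) set" where "B = Inr ` {..<length s}"
  define h where "h = case_sum ((!) \<sigma>) ((!) s)"
  define q where "q = (\<lambda>i. convex hull (h ` (A - {i})) \<inter> convex hull (h ` (B - {i})) \<noteq> {})"
  have hI: "h ` Inl ` I = (!) \<sigma> ` I" "h ` Inr ` I = (!) s ` I" for I
    by (auto simp: h_def image_image)
  have AB: "finite A" "finite B" "A \<inter> B = {}" "card A = length \<sigma>" "card B = length s"
    by (auto simp: A_def B_def card_image)
  have diff: "A - {Inl i} = Inl ` ({..<length \<sigma>} - {i})" "B - {Inl i} = B"
    "A - {Inr i} = A" "B - {Inr i} = Inr ` ({..<length s} - {i})" for i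
    by (auto simp: A_def B_def)
  have "even (card {i \<in> A \<union> B. q i})"
    unfolding q_def
  proof (rule even_card_facet_meets)
    fix A' B' assume "A' \<subseteq> A" "B' \<subseteq> B" and card: "card A' + card B' \<le> DIM('a) + 1"
    then obtain I J where IJ: "A' = Inl ` I" "B' = Inr ` J" "I \<subseteq> {..<length \<sigma>}" "J \<subseteq> {..<length s}"
      unfolding A_def B_def by (auto simp: subset_image_iff)
    with card show "convex hull (h ` A') \<inter> convex hull (h ` B') = {}"
      unfolding IJ hI by (intro gen) (auto simp: card_image)
  qed (use AB len in auto)
  then have "(\<Sum>i\<in>A \<union> B. of_bool (q i)) = (0 :: bit)"
    by (subst sum_of_bool_bit) (use AB in auto)
  moreover have "(\<Sum>i\<in>A. of_bool (q i)) = bd (\<lambda>\<tau>. meet \<tau> s) \<sigma>"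
  proof -
    have "(\<Sum>i\<in>A. of_bool (q i)) = (\<Sum>i<length \<sigma>. of_bool (q (Inl i)) :: bit)"
      unfolding A_def by (subst sum.reindex) auto
    also have "\<dots> = bd (\<lambda>\<tau>. meet \<tau> s) \<sigma>"
      unfolding bd_eq_sum meet_def set_remove_nth q_def diff hI
      by (simp add: B_def hI nth_image[of "length s" s, simplified] lessThan_atLeast0)
    finally show ?thesis .
  qed
  moreover have "(\<Sum>i\<in>B. of_bool (q i)) = bd (meet \<sigma>) s"
  proof -
    have "(\<Sum>i\<in>B. of_bool (q i)) = (\<Sum>i<length s. of_bool (q (Inr i)) :: bit)"
      unfolding B_def by (subst sum.reindex) auto
    also have "\<dots> = bd (meet \<sigma>) s"
      unfolding bd_eq_sum meet_def set_remove_nth q_def diff hI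
      by (simp add: A_def hI nth_image[of "length \<sigma>" \<sigma>, simplified] lessThan_atLeast0)
    finally show ?thesis .
  qed
  ultimately show ?thesis
    using AB by (simp add: sum.union_disjoint add.commute del: sum_of_bool_eq)
qed

section \<open>Perturbation into general position\<close>

text \<open>Only the position of the images under \<open>f\<close> relative to \<open>D\<close> is
  constrained; \<open>D\<close> itself may be as degenerate as the rational points are. The bound
  \<open>DIM('a) + 1\<close> is where the dimensions of the two affine hulls add up to less than
  that of the space.\<close>

definition general_position :: "'a::euclidean_space set \<Rightarrow> ('b \<Rightarrow> 'a) \<Rightarrow> 'b set \<Rightarrow> bool" where
  "general_position D f Q \<longleftrightarrow> (\<forall>T S. T \<subseteq> D \<longrightarrow> S \<subseteq> Q \<longrightarrow> finite T \<longrightarrow> finite S \<longrightarrow>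
      card T + card S \<le> DIM('a) + 1 \<longrightarrow> affine hull T \<inter> affine hull (f ` S) = {})"

lemma general_position_meet_parity:
  fixes \<sigma> :: "'a::euclidean_space list"
  assumes "general_position D f Q" "set \<sigma> \<subseteq> D" "distinct ys" "set ys \<subseteq> Q"
    and "length \<sigma> + length ys = DIM('a) + 3"
  shows "bd (\<lambda>zs. meet \<sigma> (map f zs)) ys + bd (\<lambda>\<tau>. meet \<tau> (map f ys)) \<sigma> = 0"
proof -
  have "bd (meet \<sigma>) (map f ys) + bd (\<lambda>\<tau>. meet \<tau> (map f ys)) \<sigma> = 0"
  proof (rule meet_parity)
    fix I J assume IJ: "I \<subseteq> {..<length \<sigma>}" "J \<subseteq> {..<length (map f ys)}" "card I + card J \<le> DIM('a) + 1"
    then have fin: "finite I" "finite J" by (auto intro: finite_subset)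
    have "card ((!) \<sigma> ` I) \<le> card I" "card ((!) ys ` J) \<le> card J"
      using fin by (auto intro: card_image_le)
    moreover have "(!) \<sigma> ` I \<subseteq> D" "(!) ys ` J \<subseteq> Q"
      using IJ assms(2,4) by (auto simp: subset_iff)
    ultimately have "affine hull ((!) \<sigma> ` I) \<inter> affine hull (f ` (!) ys ` J) = {}"
      using assms(1) IJ(3) fin unfolding general_position_def by simp
    moreover have "f ` (!) ys ` J = (!) (map f ys) ` J"
      using IJ(2) by (force simp: image_image)
    ultimately show "convex hull ((!) \<sigma> ` I) \<inter> convex hull ((!) (map f ys) ` J) = {}"
      using convex_hull_subset_affine_hull by (metis (no_types, lifting) disjoint_iff subset_iff)
  qed (use assms in simp)
  then show ?thesis by (simp add: bd_map)
qed

lemma negligible_affine_hull_card: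
  fixes T :: "'a::euclidean_space set"
  assumes "finite T" "card T \<le> DIM('a)"
  shows "negligible (affine hull T)"
proof -
  have "aff_dim (affine hull T) < int (DIM('a))"
    using aff_dim_le_card[OF assms(1)] assms(2) by simp
  then obtain a b where "a \<noteq> 0" "affine hull T \<subseteq> {x. a \<bullet> x = b}"
    using aff_lowdim_subset_hyperplane by metis
  then show ?thesis using negligible_hyperplane negligible_subset by blast
qed

text \<open>The coefficient \<open>v\<close> of \<open>x\<close> in \<open>y\<close> is nonzero,
  otherwise \<open>y\<close> would lie in the hull of \<open>S\<close>; so one can solve for
  \<open>x\<close>.\<close>

lemma affine_hull_exchange:
  fixes x y :: "'a::real_vector"
  assumes S: "finite S" and y: "y \<in> affine hull (insert x S)" "y \<notin> affine hull S"
  shows "x \<in> affine hull (insert y S)"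
proof -
  have step: "z \<in> affine hull (insert a S) \<longleftrightarrow>
      (\<exists>v u. sum u S = 1 - v \<and> (\<Sum>x\<in>S. u x *\<^sub>R x) = z - v *\<^sub>R a)" for z a
    using affine_hull_finite[of "insert a S"] affine_hull_finite_step[OF S, of a 1 z] S by simp
  obtain v u where vu: "sum u S = 1 - v" "(\<Sum>x\<in>S. u x *\<^sub>R x) = y - v *\<^sub>R x"
    using y(1) step by blast
  have v: "v \<noteq> 0"
  proof
    assume "v = 0"
    with vu have "y \<in> affine hull S" using S by (auto simp: affine_hull_finite)
    with y(2) show False by simp
  qed
  have "(\<Sum>x\<in>S. (- u x / v) *\<^sub>R x) = (- 1 / v) *\<^sub>R (\<Sum>x\<in>S. u x *\<^sub>R x)"
    unfolding scaleR_right.sum by (intro sum.cong) auto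
  then have "(\<Sum>x\<in>S. (- u x / v) *\<^sub>R x) = x - (1 / v) *\<^sub>R y"
    using v vu(2) by (simp add: scaleR_diff_right)
  moreover have "(\<Sum>x\<in>S. - u x / v) = - sum u S / v"
    by (simp add: sum_negf sum_divide_distrib)
  then have "(\<Sum>x\<in>S. - u x / v) = 1 - 1 / v"
    using v vu(1) by (simp add: field_simps)
  ultimately show ?thesis unfolding step by blast
qed

text \<open>The points are moved one at a time. Each new position avoids the affine hulls of at most
  \<open>DIM('a)\<close> points of \<open>D\<close> and earlier images: countably many null
  sets.\<close>

lemma exists_general_position:
  fixes Q D :: "'a::euclidean_space set"
  assumes "finite Q" "countable D" "e > 0"
  shows "\<exists>f. (\<forall>x\<in>Q. dist x (f x) < e) \<and> general_position D f Q"
  using assms(1)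
proof (induction Q rule: finite_induct)
  case empty
  show ?case by (auto simp: general_position_def)
next
  case (insert x Q)
  then obtain f where f: "\<forall>x\<in>Q. dist x (f x) < e" "general_position D f Q" by blast
  let ?F = "{R. R \<subseteq> D \<union> f ` Q \<and> finite R \<and> card R \<le> DIM('a)}"
  have "countable ?F"
  proof (rule countable_subset)
    show "countable {R. finite R \<and> R \<subseteq> D \<union> f ` Q}"
      using assms(2) insert(1) by (intro countable_Collect_finite_subset) (auto simp: countable_finite)
  qed auto
  then have "negligible (\<Union>R\<in>?F. affine hull R)"
    by (intro negligible_countable_Union) (auto intro: negligible_affine_hull_card)
  moreover have "\<not> negligible (ball x e)"
    using assms(3) by (intro open_not_negligible) auto
  ultimately obtain y where y: "dist x y < e" "\<And>R. R \<in> ?F \<Longrightarrow> y \<notin> affine hull R"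
    by (metis (no_types, lifting) UN_iff mem_ball negligible_subset subsetI)
  define f' where "f' = f(x := y)"
  have "general_position D f' (insert x Q)"
    unfolding general_position_def
  proof (intro allI impI)
    fix T S assume TS: "T \<subseteq> D" "S \<subseteq> insert x Q" "finite T" "finite S" "card T + card S \<le> DIM('a) + 1"
    have f': "f' ` R = f ` R" if "R \<subseteq> Q" for R
      using that insert(2) by (auto simp: f'_def image_def)
    show "affine hull T \<inter> affine hull (f' ` S) = {}"
    proof (cases "x \<in> S")
      case False
      then have "S \<subseteq> Q" using TS by auto
      with f' f(2) TS show ?thesis unfolding general_position_def by auto
    next
      case True
      define S' where "S' = S - {x}"
      have S': "S' \<subseteq> Q" "finite S'" "card S = Suc (card S')" "f' ` S = insert y (f ` S')"
        using TS True f'[of S'] card_Suc_Diff1[of S x] by (auto simp: S'_def f'_def)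
      have disj: "affine hull T \<inter> affine hull (f ` S') = {}"
        using f(2) TS S' unfolding general_position_def by auto
      show ?thesis
      proof (rule ccontr)
        assume "affine hull T \<inter> affine hull (f' ` S) \<noteq> {}"
        then obtain z where z: "z \<in> affine hull T" "z \<in> affine hull (insert y (f ` S'))"
          using S'(4) by auto
        \<comment> \<open>Exchanging \<open>y\<close> with the common point \<open>z\<close> puts
          \<open>y\<close> into the hull of a set that its choice avoided.\<close>
        then have "y \<in> affine hull (insert z (f ` S'))"
          using affine_hull_exchange disj S'(2) by blast
        also have "\<dots> \<subseteq> affine hull (T \<union> f ` S')"
          using z(1) hull_mono[of T "T \<union> f ` S'" affine] hull_subset[of "T \<union> f ` S'" affine]
          by (intro hull_minimal) auto
        finally have "y \<in> affine hull (T \<union> f ` S')" .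
        moreover have "card (T \<union> f ` S') \<le> DIM('a)"
          using card_Un_le[of T "f ` S'"] card_image_le[OF S'(2), of f] TS(5) S'(3) by linarith
        then have "T \<union> f ` S' \<in> ?F" using TS S' by auto
        ultimately show False using y(2) by blast
      qed
    qed
  qed
  moreover have "\<forall>x'\<in>insert x Q. dist x' (f' x') < e" using f(1) y(1) by (auto simp: f'_def)
  ultimately show ?case by blast
qed

subsection \<open>Barycentric subdivision of a large simplex\<close>

definition bary :: "'a::real_vector list \<Rightarrow> 'a" where
  "bary xs = (1 / real (length xs)) *\<^sub>R sum_list xs"

lemma bary_eq_sum: "bary xs = (\<Sum>i<length xs. (1 / real (length xs)) *\<^sub>R xs ! i)"
  by (simp add: bary_def sum_list_sum_nth scaleR_right.sum lessThan_atLeast0)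

lemma bary_in_convex:
  assumes "convex S" "xs \<noteq> []" "set xs \<subseteq> S"
  shows "bary xs \<in> S"
  unfolding bary_eq_sum using assms by (intro convex_sum) (auto simp: subset_iff)

text \<open>In the average of the differences to \<open>v\<close>, the term of \<open>v\<close>
  itself vanishes.\<close>

lemma dist_bary_le:
  fixes xs :: "'a::real_normed_vector list"
  assumes "v \<in> set xs" "\<And>p. p \<in> set xs \<Longrightarrow> dist p v \<le> e"
  shows "dist (bary xs) v \<le> (1 - 1 / real (length xs)) * e"
proof -
  let ?n = "length xs"
  obtain j where j: "j < ?n" "xs ! j = v" using assms(1) by (auto simp: in_set_conv_nth)
  have "bary xs - v = (\<Sum>i<?n. (1 / real ?n) *\<^sub>R (xs ! i - v))"
    using j by (auto simp: bary_eq_sum scaleR_diff_right sum_subtractf scaleR_left.sum[symmetric])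
  also have "\<dots> = (\<Sum>i\<in>{..<?n} - {j}. (1 / real ?n) *\<^sub>R (xs ! i - v))"
    using j by (intro sum.mono_neutral_right) auto
  also have "norm \<dots> \<le> (\<Sum>i\<in>{..<?n} - {j}. (1 / real ?n) * e)"
    using assms(2) by (intro sum_norm_le) (auto simp: dist_norm intro!: divide_right_mono)
  also have "\<dots> = (1 - 1 / real ?n) * e"
    using j by (cases "?n = 0") (auto simp: of_nat_diff field_simps simp flip: distrib_left distrib_right)
  finally show ?thesis by (simp add: dist_norm)
qed

lemma set_sd_bary:
  assumes "\<rho> \<in> set (sd bary xs)"
  shows "set \<rho> \<subseteq> convex hull (set xs)"
  using set_sd[of "convex hull (set xs)" bary xs \<rho>] assms
  by (simp add: bary_in_convex hull_subset)

lemma set_sdh_bary: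
  assumes "\<rho> \<in> set (sdh bary xs)"
  shows "set \<rho> \<subseteq> convex hull (set xs)"
  using set_sdh[of "convex hull (set xs)" bary xs \<rho>] assms
  by (simp add: bary_in_convex hull_subset)

lemma set_sdn_bary:
  assumes "\<rho> \<in> set (sdn bary m xs)"
  shows "set \<rho> \<subseteq> convex hull (set xs)"
  using set_sdn[of "convex hull (set xs)" bary xs \<rho>] assms
  by (simp add: bary_in_convex hull_subset)

text \<open>Distances from the barycentre are bounded at the vertices by \<open>dist_bary_le\<close>
  and elsewhere by convexity; the other pairs lie in a subdivided facet. The uniform
  \<open>M\<close> gives one factor for all face lengths.\<close>

lemma sd_bary_mesh:
  fixes xs :: "'a::real_normed_vector list"
  assumes "length xs \<le> M" "e \<ge> 0" "\<And>p q. p \<in> set xs \<Longrightarrow> q \<in> set xs \<Longrightarrow> dist p q \<le> e"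
    and "\<rho> \<in> set (sd bary xs)" "p \<in> set \<rho>" "q \<in> set \<rho>"
  shows "dist p q \<le> (1 - 1 / real M) * e"
  using assms
proof (induction "length xs" arbitrary: xs \<rho> p q rule: less_induct)
  case less
  show ?case
  proof (cases "xs = []")
    case True
    with less.prems show ?thesis by (simp add: sd.simps)
  next
    case False
    let ?r = "(1 - 1 / real M) * e"
    obtain \<tau> \<rho>' where \<tau>: "\<tau> \<in> set (faces xs)" "\<rho>' \<in> set (sd bary \<tau>)" "\<rho> = bary xs # \<rho>'"
      using less.prems(4) by (auto simp: in_sd_iff[OF False])
    have L: "length xs > 0" using False by simp
    then have r: "(1 - 1 / real (length xs)) * e \<le> ?r"
      using less.prems(1,2) by (intro mult_right_mono) (auto simp: frac_le)
    have r0: "?r \<ge> 0" using L less.prems(1,2) by (intro mult_nonneg_nonneg) (auto simp: divide_le_eq)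
    have "set xs \<subseteq> cball (bary xs) ?r"
      using dist_bary_le[of _ xs e] less.prems(3) r by fastforce
    then have "convex hull (set xs) \<subseteq> cball (bary xs) ?r"
      by (intro hull_minimal) auto
    then have far: "dist (bary xs) y \<le> ?r" if "y \<in> set \<rho>'" for y
      using set_sd_bary[OF \<tau>(2)] hull_mono[OF set_faces[OF \<tau>(1)], of convex] that by (auto simp: subset_iff)
    have near: "dist y z \<le> ?r" if "y \<in> set \<rho>'" "z \<in> set \<rho>'" for y z
    proof (rule less(1)[OF length_faces_less[OF \<tau>(1)] _ less.prems(2) _ \<tau>(2) that])
      show "length \<tau> \<le> M" using length_faces_less[OF \<tau>(1)] less.prems(1) by simp
      show "dist p q \<le> e" if "p \<in> set \<tau>" "q \<in> set \<tau>" for p q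
        using that set_faces[OF \<tau>(1)] less.prems(3) by blast
    qed
    have "p = bary xs \<or> p \<in> set \<rho>'" "q = bary xs \<or> q \<in> set \<rho>'" using less.prems(5,6) \<tau>(3) by auto
    then show ?thesis using far near r0 by (metis dist_commute dist_self)
  qed
qed

lemma sdn_bary_mesh:
  fixes xs :: "'a::real_normed_vector list"
  assumes "length xs \<le> M" "M \<ge> 1" "e \<ge> 0" "\<And>p q. p \<in> set xs \<Longrightarrow> q \<in> set xs \<Longrightarrow> dist p q \<le> e"
    and "\<rho> \<in> set (sdn bary m xs)" "p \<in> set \<rho>" "q \<in> set \<rho>"
  shows "dist p q \<le> (1 - 1 / real M) ^ m * e"
  using assms(5-7)
proof (induction m arbitrary: \<rho> p q)
  case 0
  with assms(4) show ?case by simp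
next
  case (Suc m)
  then obtain \<sigma> where \<sigma>: "\<sigma> \<in> set (sdn bary m xs)" "\<rho> \<in> set (sd bary \<sigma>)" by auto
  have "dist p q \<le> (1 - 1 / real M) * ((1 - 1 / real M) ^ m * e)"
  proof (rule sd_bary_mesh[OF _ _ _ \<sigma>(2) Suc.prems(2,3)])
    show "length \<sigma> \<le> M" using length_sdn[OF \<sigma>(1)] assms(1) by simp
    show "0 \<le> (1 - 1 / real M) ^ m * e" using assms(2,3) by simp
  qed (rule Suc.IH[OF \<sigma>(1)])
  then show ?case by simp
qed

lemma exists_fine_subdivision:
  fixes xs :: "'a::real_normed_vector list"
  assumes "\<delta> > 0"
  shows "\<exists>m. \<forall>\<tau>. set \<tau> \<subseteq> set xs \<longrightarrow> length \<tau> \<le> length xs \<longrightarrow>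
    (\<forall>\<rho>\<in>set (sdn bary m \<tau>). \<forall>p\<in>set \<rho>. \<forall>q\<in>set \<rho>. dist p q \<le> \<delta>)"
proof -
  define M where "M = Suc (length xs)"
  have "bounded (set xs)" by (simp add: finite_imp_bounded)
  then obtain e where e: "\<And>p q. p \<in> set xs \<Longrightarrow> q \<in> set xs \<Longrightarrow> dist p q \<le> e"
    using bounded_two_points by metis
  define e' where "e' = max e 0"
  have e': "e' \<ge> 0" "\<And>p q. p \<in> set xs \<Longrightarrow> q \<in> set xs \<Longrightarrow> dist p q \<le> e'"
    using e by (auto simp: e'_def le_max_iff_disj)
  have "(\<lambda>m. (1 - 1 / real M) ^ m * e') \<longlonglongrightarrow> 0 * e'"
    by (intro tendsto_intros LIMSEQ_power_zero) (simp add: M_def)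
  then have "eventually (\<lambda>m. (1 - 1 / real M) ^ m * e' < \<delta>) sequentially"
    using assms by (intro order_tendstoD) auto
  then obtain m where m: "(1 - 1 / real M) ^ m * e' < \<delta>"
    by (auto simp: eventually_sequentially)
  show ?thesis
  proof (intro exI[of _ m] allI impI ballI)
    fix \<tau> \<rho> p q assume *: "set \<tau> \<subseteq> set xs" "length \<tau> \<le> length xs"
      "\<rho> \<in> set (sdn bary m \<tau>)" "p \<in> set \<rho>" "q \<in> set \<rho>"
    have "dist p q \<le> (1 - 1 / real M) ^ m * e'"
      by (rule sdn_bary_mesh[OF _ _ e'(1) _ *(3-5)]) (use *(1,2) e'(2) in \<open>auto simp: M_def\<close>)
    with m show "dist p q \<le> \<delta>" by simp
  qed
qed

text \<open>By \<open>sdh_homotopy\<close> a subdivision changes the value by coboundaries, which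
  vanish, and by values of \<open>g\<close> on the homotopies of the facets, whose simplices are
  flattened into the hull of a facet.\<close>

lemma sdn_eval_cocycle:
  fixes g :: "'a::real_vector list \<Rightarrow> bit"
  assumes D: "\<And>ys. ys \<noteq> [] \<Longrightarrow> set ys \<subseteq> D \<Longrightarrow> bary ys \<in> D"
    and cocycle: "\<And>\<rho>. length \<rho> = Suc n \<Longrightarrow> set \<rho> \<subseteq> D \<Longrightarrow> bd g \<rho> = 0"
    and degenerate: "\<And>\<rho> \<tau>. length \<rho> = n \<Longrightarrow> set \<tau> \<subseteq> D \<Longrightarrow> Suc (length \<tau>) = n \<Longrightarrow> 
                        set \<rho> \<subseteq> convex hull (set \<tau>) \<Longrightarrow> g \<rho> = 0"
    and \<sigma>: "length \<sigma> = n" "set \<sigma> \<subseteq> D"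
  shows "(\<Sum>\<rho>\<leftarrow>sdn bary m \<sigma>. g \<rho>) = g \<sigma>"
proof (induction m)
  case (Suc m)
  have sd: "(\<Sum>\<rho>\<leftarrow>sd bary xs. g \<rho>) = g xs" if xs: "length xs = n" "set xs \<subseteq> D" for xs
  proof -
    have "(\<Sum>\<rho>\<leftarrow>sdh bary xs. bd g \<rho>) = (\<Sum>\<rho>\<leftarrow>sdh bary xs. 0)"
      using set_sdh[OF D xs(2)] length_sdh[of _ bary xs] xs(1)
      by (intro arg_cong[of _ _ sum_list] map_cong refl cocycle) auto
    moreover have "bd (\<lambda>\<tau>. \<Sum>\<rho>\<leftarrow>sdh bary \<tau>. g \<rho>) xs = 0"
    proof (rule bd_eq_0)
      fix \<tau> assume \<tau>: "\<tau> \<in> set (faces xs)"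
      have "g \<rho> = 0" if "\<rho> \<in> set (sdh bary \<tau>)" for \<rho>
        using that \<tau> xs length_faces[OF \<tau>] set_faces[OF \<tau>] length_sdh[OF that] set_sdh_bary[OF that]
        by (intro degenerate[of \<rho> \<tau>]) auto
      then show "(\<Sum>\<rho>\<leftarrow>sdh bary \<tau>. g \<rho>) = 0"
        by (simp cong: map_cong)
    qed
    ultimately show ?thesis
      using sdh_homotopy[of g bary xs] by (simp add: bit_add_eq_0_iff)
  qed
  have "(\<Sum>\<rho>\<leftarrow>sdn bary (Suc m) \<sigma>. g \<rho>) = (\<Sum>\<rho>\<leftarrow>sdn bary m \<sigma>. \<Sum>\<rho>'\<leftarrow>sd bary \<rho>. g \<rho>')"
    by (simp only: sdn.simps sum_list_concat_map)
  also have "\<dots> = (\<Sum>\<rho>\<leftarrow>sdn bary m \<sigma>. g \<rho>)"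
    using length_sdn[of _ bary m \<sigma>] set_sdn[OF D \<sigma>(2)] \<sigma>(1)
    by (intro arg_cong[of _ _ sum_list] map_cong refl sd) auto
  finally show ?case using Suc by simp
qed simp

section \<open>A countable supply of vertices and a large simplex\<close>

definition rational_points :: "'a::euclidean_space set" where
  "rational_points = {v. \<forall>b\<in>Basis. v \<bullet> b \<in> \<rat>}"

lemma countable_rational_points: "countable (rational_points :: 'a::euclidean_space set)"
proof (rule countable_image_inj_on)
  let ?h = "\<lambda>v::'a. \<lambda>b\<in>Basis. v \<bullet> b"
  show "countable (?h ` rational_points)"
  proof (rule countable_subset)
    show "?h ` rational_points \<subseteq> (\<Pi>\<^sub>E b\<in>Basis. \<rat>)" by (auto simp: rational_points_def)
    show "countable (\<Pi>\<^sub>E b\<in>(Basis::'a set). (\<rat>::real set))"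
      by (intro countable_PiE) (auto simp: countable_rat)
  qed
  show "inj_on ?h rational_points"
  proof (rule inj_onI)
    fix x y :: 'a assume eq: "?h x = ?h y"
    have "x \<bullet> b = y \<bullet> b" if "b \<in> Basis" for b
      using fun_cong[OF eq, of b] that by simp
    then show "x = y" by (rule euclidean_eqI)
  qed
qed

lemma bary_rational_points: "set ys \<subseteq> rational_points \<Longrightarrow> bary ys \<in> rational_points"
  by (auto simp: rational_points_def bary_eq_sum inner_sum_left subset_iff intro!: Rats_sum Rats_mult Rats_divide)

lemma faces_map: "faces (map h xs) = map (map h) (faces xs)"
  by (induction xs) auto

lemma exists_big_simplex:
  assumes "r \<ge> 0"
  shows "\<exists>\<Delta> :: 'a::euclidean_space list. length \<Delta> = DIM('a) + 1 \<and> set \<Delta> \<subseteq> rational_points \<and>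
    cball 0 r \<subseteq> convex hull (set \<Delta>) \<and> (\<forall>\<tau>\<in>set (faces \<Delta>). \<forall>v\<in>convex hull (set \<tau>). norm v > r)"
proof -
  let ?d = "DIM('a)"
  \<comment> \<open>\<open>K\<close> bounds the norms of the facet normals \<open>c\<close> below,
    and exceeds \<open>2 * DIM('a) + 1\<close>, which makes the ball fit inside.\<close>
  define K where "K = norm (One::'a) + 2 * real ?d + 2"
  have K0: "K > 0" by (simp add: K_def add_nonneg_pos)
  obtain N :: nat where N: "real N > r * K" using reals_Archimedean2 by blast
  then have N0: "real N > 0" using assms K0 by (smt (verit) mult_nonneg_nonneg)
  define h where "h = (\<lambda>b::'a. if b = 0 then - real N *\<^sub>R One else real N *\<^sub>R b)"
  obtain xs where xs: "set xs = insert (0::'a) Basis" "distinct xs"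
    using finite_distinct_list[of "insert (0::'a) Basis"] by auto
  have nz: "(0::'a) \<notin> Basis" by auto
  have hb: "h b = real N *\<^sub>R b" if "b \<in> Basis" for b using that nz by (auto simp: h_def)
  define \<Delta> where "\<Delta> = map h xs"
  have "length \<Delta> = ?d + 1"
    using distinct_card[OF xs(2)] xs(1) nz by (simp add: \<Delta>_def)
  moreover have "set \<Delta> \<subseteq> rational_points"
    by (auto simp: \<Delta>_def xs rational_points_def h_def inner_sum_left_Basis inner_Basis)
  moreover have "cball 0 r \<subseteq> convex hull (set \<Delta>)"
  proof
    fix y :: 'a assume "y \<in> cball 0 r"
    then have y: "norm y \<le> r" by simp
    define s where "s = (\<Sum>b\<in>Basis. y \<bullet> b)"
    \<comment> \<open>The weight \<open>l\<close> on all vertices cancels, as they sum to zero;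
      adding \<open>(y \<bullet> b) / real N\<close> at \<open>h b\<close> produces
      \<open>y\<close>, and this value of \<open>l\<close> makes the total weight 1.\<close>
    define l where "l = (1 - s / real N) / (real ?d + 1)"
    have yb: "\<bar>y \<bullet> b\<bar> \<le> r" if "b \<in> Basis" for b using Basis_le_norm[OF that, of y] y by simp
    have "s \<le> (\<Sum>b\<in>(Basis::'a set). r)"
      unfolding s_def using yb by (intro sum_mono) (simp add: abs_le_iff)
    then have s: "s \<le> real ?d * r" by simp
    have "r * (2 * real ?d + 1) \<le> r * K" using assms by (intro mult_left_mono) (auto simp: K_def)
    then have "r * (real ?d + 1) + s \<le> real N" using N s by (simp add: algebra_simps)
    then have "r * (real ?d + 1) / (real N * (real ?d + 1)) \<le> (real N - s) / (real N * (real ?d + 1))"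
      by (intro divide_right_mono) auto
    also have "\<dots> = l" using N0 by (simp add: l_def diff_divide_distrib)
    finally have l: "r / real N \<le> l" by simp
    define \<alpha> where "\<alpha> = (\<lambda>b. if b = 0 then l else (y \<bullet> b) / real N + l)"
    have \<alpha>b: "\<alpha> b = (y \<bullet> b) / real N + l" if "b \<in> Basis" for b using that nz by (auto simp: \<alpha>_def)
    have "\<forall>b\<in>insert 0 Basis. \<alpha> b \<ge> 0"
    proof
      fix b :: 'a assume "b \<in> insert 0 Basis"
      then consider "b = 0" | "b \<in> Basis" by blast
      then show "\<alpha> b \<ge> 0"
      proof cases
        case 1
        then show ?thesis using l assms N0 by (smt (verit) \<alpha>_def divide_nonneg_pos)
      next
        case 2
        have "- (y \<bullet> b) / real N \<le> r / real N"
          using yb[OF 2] N0 by (intro divide_right_mono) auto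
        with l \<alpha>b[OF 2] show ?thesis by simp
      qed
    qed
    moreover have "sum \<alpha> (insert 0 Basis) = 1"
    proof -
      have "sum \<alpha> (insert 0 Basis) = l + (\<Sum>b\<in>Basis. (y \<bullet> b) / real N + l)"
        using nz \<alpha>b by (simp add: \<alpha>_def[THEN fun_cong, of 0])
      also have "\<dots> = l * (real ?d + 1) + s / real N"
        by (simp add: sum.distrib s_def sum_divide_distrib algebra_simps)
      also have "\<dots> = 1" by (simp add: l_def)
      finally show ?thesis .
    qed
    moreover have "(\<Sum>b\<in>insert 0 Basis. \<alpha> b *\<^sub>R h b) = y"
    proof -
      have "(\<Sum>b\<in>insert 0 Basis. \<alpha> b *\<^sub>R h b) = l *\<^sub>R h 0 + (\<Sum>b\<in>Basis. ((y \<bullet> b) / real N + l) *\<^sub>R (real N *\<^sub>R b))"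
        using nz \<alpha>b hb by (simp add: \<alpha>_def[THEN fun_cong, of 0])
      also have "(\<Sum>b\<in>Basis. ((y \<bullet> b) / real N + l) *\<^sub>R (real N *\<^sub>R b)) = (\<Sum>b\<in>Basis. (y \<bullet> b) *\<^sub>R b + (l * real N) *\<^sub>R b)"
        using N0 by (intro sum.cong) (auto simp: algebra_simps)
      also have "\<dots> = y + (l * real N) *\<^sub>R One"
        by (simp add: sum.distrib euclidean_representation scaleR_right.sum)
      finally show ?thesis by (simp add: h_def)
    qed
    ultimately have "y \<in> convex hull (h ` insert 0 Basis)"
      using finite_Basis by (intro convex_hull_image_iff[THEN iffD2] exI[of _ \<alpha>]) auto
    then show "y \<in> convex hull (set \<Delta>)" by (simp add: \<Delta>_def xs)
  qed
  moreover have "norm v > r" if "\<tau> \<in> set (faces \<Delta>)" "v \<in> convex hull (set \<tau>)" for \<tau> v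
  proof -
    obtain \<tau>' where \<tau>': "\<tau>' \<in> set (faces xs)" "\<tau> = map h \<tau>'"
      using \<open>\<tau> \<in> set (faces \<Delta>)\<close> by (auto simp: \<Delta>_def faces_map)
    then obtain a where a: "a \<in> insert 0 Basis" "set \<tau>' = insert 0 Basis - {a}"
      using distinct_face_set[OF xs(2) \<tau>'(1)] unfolding xs(1) by blast
    \<comment> \<open>The functional that takes the value \<open>N\<close> at every vertex except
      \<open>h a\<close>.\<close>
    define c where "c = One - (real ?d + 1) *\<^sub>R a"
    have "h ` (insert 0 Basis - {a}) \<subseteq> {y. c \<bullet> y \<ge> real N}"
    proof safe
      fix b assume b: "b \<in> Basis" "b \<noteq> a"
      then have "a \<bullet> b = 0" using a(1) by (auto simp: inner_Basis)
      with b show "c \<bullet> h b \<ge> real N"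
        by (simp add: c_def hb inner_diff_left inner_sum_left_Basis)
    next
      assume "0 \<noteq> a"
      then have "a \<in> Basis" using a by auto
      have "(One::'a) \<bullet> One = real ?d" by (simp add: inner_sum_left inner_sum_right inner_Basis)
      moreover have "a \<bullet> One = 1" using \<open>a \<in> Basis\<close> by (simp add: inner_commute[of a] inner_sum_left_Basis)
      ultimately show "c \<bullet> h 0 \<ge> real N"
        by (simp add: c_def h_def inner_diff_left algebra_simps)
    qed
    then have "convex hull (set \<tau>) \<subseteq> {y. c \<bullet> y \<ge> real N}"
      unfolding \<tau>'(2) set_map a(2) by (intro hull_minimal convex_halfspace_ge)
    then have "real N \<le> c \<bullet> v" using that by auto
    also have "\<dots> \<le> norm c * norm v" by (rule norm_cauchy_schwarz)
    also have "\<dots> \<le> K * norm v"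
    proof (rule mult_right_mono)
      have "norm a \<le> 1" using a(1) by auto
      have "norm c \<le> norm (One::'a) + norm ((real ?d + 1) *\<^sub>R a)"
        unfolding c_def by (rule norm_triangle_ineq4)
      also have "\<dots> = norm (One::'a) + (real ?d + 1) * norm a" by simp
      also have "\<dots> \<le> norm (One::'a) + (real ?d + 1) * 1"
        using \<open>norm a \<le> 1\<close> by (intro add_left_mono mult_left_mono) auto
      finally have "norm c \<le> norm (One::'a) + (real ?d + 1)" by simp
      then show "norm c \<le> K" by (simp add: K_def)
    qed simp
    finally have "r * K < norm v * K" using N by (simp add: mult.commute)
    then show "norm v > r" using K0 by simp
  qed
  ultimately show ?thesis by blast
qed

subsection \<open>Compactness\<close>

text \<open>The sum of the distances to the sets has a positive minimum on one of them; a point too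
  close to all sets would produce a smaller value.\<close>

lemma compact_inter_approximable:
  fixes C :: "'v \<Rightarrow> 'a::euclidean_space set"
  assumes V: "finite V" "\<And>v. v \<in> V \<Longrightarrow> compact (C v)"
    and S: "S \<subseteq> V" "S \<noteq> {}" "(\<Inter>v\<in>S. C v) = {}"
  shows "\<exists>e>0. \<forall>p. \<exists>v\<in>S. \<forall>y\<in>C v. dist p y > e"
proof (rule ccontr)
  assume "\<not> ?thesis"
  then have ex: "\<exists>p. \<forall>v\<in>S. \<exists>y\<in>C v. dist p y \<le> e" if "e > 0" for e
    using that by (meson not_less)
  obtain v0 where v0: "v0 \<in> S" using S by blast
  define f where "f = (\<lambda>y. \<Sum>v\<in>S. infdist y (C v))"
  have fin: "finite S" using S V finite_subset by blast
  have ne: "C v \<noteq> {}" if "v \<in> S" for v using ex[of 1] that by auto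
  obtain y0 where y0: "y0 \<in> C v0" "\<And>y. y \<in> C v0 \<Longrightarrow> f y0 \<le> f y"
    using continuous_attains_inf[of "C v0" f] V(2) v0 S(1) ne
    unfolding f_def by (force intro!: continuous_intros)
  have "f y0 \<ge> 0" unfolding f_def by (intro sum_nonneg infdist_nonneg)
  moreover have "f y0 \<noteq> 0"
  proof
    assume "f y0 = 0"
    then have "\<forall>v\<in>S. infdist y0 (C v) = 0"
      unfolding f_def using sum_nonneg_eq_0_iff[OF fin, of "\<lambda>v. infdist y0 (C v)"] infdist_nonneg by blast
    then have "y0 \<in> C v" if "v \<in> S" for v
      using that in_closed_iff_infdist_zero[OF compact_imp_closed[OF V(2)] ne[OF that]] S(1) by blast
    with S(3) show False by blast
  qed
  ultimately have pos: "f y0 > 0" by simp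
  \<comment> \<open>A point of \<open>C v0\<close> within \<open>e\<close> of \<open>p\<close> is
    within \<open>2 * e\<close> of every set, so there \<open>f\<close> is at most
    \<open>2 * card S * e\<close>, which is below \<open>f y0\<close>.\<close>
  define e where "e = f y0 / (2 * real (card S) + 1)"
  have e: "e > 0" using pos by (simp add: e_def)
  then obtain p where p: "\<And>v. v \<in> S \<Longrightarrow> \<exists>y\<in>C v. dist p y \<le> e" using ex by blast
  obtain y where y: "y \<in> C v0" "dist p y \<le> e" using p v0 by blast
  have "f y \<le> (\<Sum>v\<in>S. 2 * e)"
    unfolding f_def
  proof (rule sum_mono)
    fix v assume "v \<in> S"
    then obtain z where z: "z \<in> C v" "dist p z \<le> e" using p by blast
    have "infdist y (C v) \<le> dist y z" using z by (intro infdist_le)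
    also have "\<dots> \<le> 2 * e" using y(2) z(2) dist_triangle3[of y z p] by simp
    finally show "infdist y (C v) \<le> 2 * e" .
  qed
  then have "f y0 \<le> 2 * real (card S) * e" using y0(2)[OF y(1)] by simp
  moreover have "f y0 = 2 * real (card S) * e + e" 
  proof -
    have "f y0 = (2 * real (card S) + 1) * e"
      unfolding e_def by (simp add: add_eq_0_iff_both_eq_0)
    then show ?thesis by (simp add: distrib_right)
  qed
  ultimately show False using e by simp
qed

text \<open>Only finitely many subfamilies have empty intersection, so one tolerance rules them all
  out; the sets met within it then share a point.\<close>

lemma exists_deep_point_of_approximate:
  fixes C :: "'v \<Rightarrow> 'a::euclidean_space set"
  assumes V: "finite V" "\<And>v. v \<in> V \<Longrightarrow> compact (C v)"
    and approx: "\<And>e. e > 0 \<Longrightarrow> \<exists>p. N \<le> real (card {v \<in> V. \<exists>y\<in>C v. dist p y \<le> e})"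
  shows "\<exists>p. N \<le> real (card {v \<in> V. p \<in> C v})"
proof (rule ccontr)
  assume "\<not> ?thesis"
  then have less: "real (card {v \<in> V. p \<in> C v}) < N" for p by (simp add: not_le)
  define F where "F = {S. S \<subseteq> V \<and> S \<noteq> {} \<and> (\<Inter>v\<in>S. C v) = {}}"
  have "finite F" using V(1) by (simp add: F_def)
  have "\<forall>S\<in>F. \<exists>e>0. \<forall>p. \<exists>v\<in>S. \<forall>y\<in>C v. dist p y > e"
    using compact_inter_approximable[OF V] by (auto simp: F_def)
  then obtain e where e: "\<And>S. S \<in> F \<Longrightarrow> e S > 0" "\<And>S p. S \<in> F \<Longrightarrow> \<exists>v\<in>S. \<forall>y\<in>C v. dist p y > e S"
    by metis
  \<comment> \<open>The 1 covers the case that \<open>F\<close> is empty.\<close>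
  define e0 where "e0 = Min (insert 1 (e ` F))"
  have e0: "e0 > 0" "\<And>S. S \<in> F \<Longrightarrow> e0 \<le> e S"
    using \<open>finite F\<close> e(1) by (auto simp: e0_def Min_gr_iff)
  obtain p where p: "N \<le> real (card {v \<in> V. \<exists>y\<in>C v. dist p y \<le> e0})" using approx e0(1) by blast
  define S where "S = {v \<in> V. \<exists>y\<in>C v. dist p y \<le> e0}"
  have "S \<noteq> {}" using p less[of p] by (auto simp: S_def[symmetric])
  have "S \<notin> F"
  proof
    assume "S \<in> F"
    then obtain v where "v \<in> S" "\<forall>y\<in>C v. dist p y > e S" using e(2) by blast
    with e0(2)[OF \<open>S \<in> F\<close>] show False by (fastforce simp: S_def)
  qed
  then obtain q where q: "\<And>v. v \<in> S \<Longrightarrow> q \<in> C v" using \<open>S \<noteq> {}\<close> by (auto simp: F_def S_def)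
  have "card S \<le> card {v \<in> V. q \<in> C v}"
    using V(1) q by (intro card_mono) (auto simp: S_def)
  with p less[of q] show False by (simp add: S_def)
qed

subsection \<open>Cofilling\<close>

definition slice :: "'b \<Rightarrow> 'b list set \<Rightarrow> 'b list set" where
  "slice x U = {ys. x # ys \<in> U}"

lemma card_slices:
  assumes "finite X" "finite U" "U \<subseteq> set_Cons X V"
  shows "(\<Sum>x\<in>X. card (slice x U)) = card U"
proof -
  have fin: "finite ((#) x ` slice x U)" for x
    using assms(2) by (rule finite_subset[rotated]) (auto simp: slice_def)
  have "U = (\<Union>x\<in>X. (#) x ` slice x U)"
    using assms(3) unfolding slice_def set_Cons_def by blast
  then have "card U = card (\<Union>x\<in>X. (#) x ` slice x U)" by simp
  also have "\<dots> = (\<Sum>x\<in>X. card ((#) x ` slice x U))"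
    using assms(1) fin by (intro card_UN_disjoint) auto
  also have "\<dots> = (\<Sum>x\<in>X. card (slice x U))"
    by (intro sum.cong refl card_image) auto
  finally show ?thesis by simp
qed

lemma finite_set_Cons: "finite X \<Longrightarrow> finite V \<Longrightarrow> finite (set_Cons X V)"
proof -
  have "set_Cons X V = (\<lambda>(x, xs). x # xs) ` (X \<times> V)" by (auto simp: set_Cons_def)
  then show "finite X \<Longrightarrow> finite V \<Longrightarrow> finite (set_Cons X V)" by simp
qed

text \<open>A bipartite graph that is the symmetric difference of two cylinders and has density below
  \<open>2 d / (d + 1)\<^sup>2 \<le> 1 / 2\<close> comes from two sets that are both smaller, or both larger, than half.\<close>

lemma same_half:
  fixes a b N :: real
  assumes "a * (N - b) + (N - a) * b < 2 * real d / (real d + 1)\<^sup>2 * N\<^sup>2"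
  shows "(N - 2 * a) * (N - 2 * b) > 0"
proof -
  have "0 \<le> (real d - 1)\<^sup>2" by simp
  then have "2 * real d / (real d + 1)\<^sup>2 \<le> 1 / 2"
    by (simp add: divide_le_eq power2_eq_square algebra_simps add_pos_nonneg)
  then have "2 * real d / (real d + 1)\<^sup>2 * N\<^sup>2 \<le> 1 / 2 * N\<^sup>2"
    by (rule mult_right_mono) simp
  moreover define e where "e = a * (N - b) + (N - a) * b"
  ultimately have "e < 1 / 2 * N\<^sup>2" using assms by simp
  moreover have "(N - 2 * a) * (N - 2 * b) = N\<^sup>2 - 2 * e"
    by (simp add: e_def algebra_simps power2_eq_square)
  ultimately show ?thesis by simp
qed

text \<open>The left side of \<open>bound\<close> is half of
  \<open>N^2 - (N - (a + b))^2 + (a - b)^2\<close>. Dropping \<open>(a - b)^2\<close> reduces to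
  \<open>a = b\<close>, where the threshold corresponds to \<open>N / (d + 1)\<close>;
  \<open>half\<close> makes \<open>N - (a + b)\<close> positive, so that roots may be taken.\<close>

lemma sum_densities_less:
  fixes a b N :: real
  assumes N: "N > 0" and bound: "a * (N - b) + (N - a) * b < 2 * real d / (real d + 1)\<^sup>2 * N\<^sup>2"
    and half: "2 * a < N" "2 * b < N" and d: "d \<ge> 1"
  shows "(real d + 1) * (a + b) < 2 * N"
proof -
  let ?c = "(real d - 1) / (real d + 1)"
  have c: "1 - 2 * (2 * real d / (real d + 1)\<^sup>2) = ?c\<^sup>2"
    by (simp add: power_divide field_simps add_pos_nonneg add_eq_0_iff_both_eq_0)
       (simp add: power2_eq_square algebra_simps)
  have "(?c * N)\<^sup>2 = N\<^sup>2 - 2 * (2 * real d / (real d + 1)\<^sup>2 * N\<^sup>2)"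
    unfolding power_mult_distrib c[symmetric] by (simp add: left_diff_distrib)
  also have "\<dots> < N\<^sup>2 - 2 * (a * (N - b) + (N - a) * b)"
    using mult_strict_left_mono[OF bound, of 2] by (intro diff_strict_left_mono) simp
  also have "\<dots> = (N - (a + b))\<^sup>2 - (a - b)\<^sup>2" by (simp add: power2_eq_square algebra_simps)
  also have "\<dots> \<le> (N - (a + b))\<^sup>2" by simp
  finally have "?c * N < N - (a + b)"
    using half by (intro power2_less_imp_less[of "?c * N"]) auto
  then have "(?c * N) * (real d + 1) < (N - (a + b)) * (real d + 1)"
    by (intro mult_strict_right_mono) auto
  moreover have "(?c * N) * (real d + 1) = (real d - 1) * N"
    by (simp add: add_eq_0_iff_both_eq_0)
  ultimately show ?thesis by (simp add: algebra_simps)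
qed

section \<open>The cochains attached to small simplices\<close>

text \<open>\<open>m\<close> is one less than the dimension, so that \<open>m\<close> and
  \<open>Suc m\<close> are the last two colours. \<open>D\<close> holds the vertices allowed for
  simplices.\<close>

locale colour_classes =
  fixes m n :: nat and P :: "nat \<Rightarrow> 'b set" and f :: "'b \<Rightarrow> 'a::euclidean_space"
    and D :: "'a set" and \<delta> :: real
  assumes dim: "DIM('a) = Suc m"
    and n: "n \<ge> 1"
    and disj: "disjoint_family_on P {..Suc m}"
    and fin: "\<And>i. i \<le> Suc m \<Longrightarrow> finite (P i)"
    and card: "\<And>i. i \<le> Suc m \<Longrightarrow> card (P i) = n"
    and gp: "general_position D f (\<Union>i\<le>Suc m. P i)"
begin

definition tuples :: "nat \<Rightarrow> 'b list set" where
  "tuples k = listset (map P [k..<Suc (Suc m)])"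

definition colours_from :: "nat \<Rightarrow> 'b set" where
  "colours_from k = (\<Union>i\<in>{k..Suc m}. P i)"

definition near :: "'a \<Rightarrow> 'b list set" where
  "near v = {ys \<in> tuples 0. convex hull (f ` set ys) \<inter> cball v \<delta> \<noteq> {}}"

text \<open>The apex is chosen for the bounding set, not for the support of a cochain, so the size
  estimates involve no cochains.\<close>

definition pick :: "nat \<Rightarrow> 'b list set \<Rightarrow> 'b" where
  "pick k U = (SOME x. x \<in> P k \<and> n * card (slice x U) \<le> card U)"

text \<open>\<open>U k \<tau>\<close> contains the support of the cochain \<open>C k \<tau>\<close> on tuples of the colours \<open>k, \<dots>, m + 1\<close>,
  where \<open>\<tau>\<close> is a small \<open>k\<close>-simplex. The cochains \<open>C k \<rho>\<close> of the facets \<open>\<rho>\<close> are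
  filled by coning from the vertex of colour \<open>k\<close> for which the bound shrinks the most.\<close>

primrec U :: "nat \<Rightarrow> 'a list \<Rightarrow> 'b list set" where
  "U 0 \<tau> = near (hd \<tau>)"
| "U (Suc k) \<tau> = (\<Union>\<rho>\<in>set (faces \<tau>). slice (pick k (U k \<rho>)) (U k \<rho>))"

abbreviation apex :: "nat \<Rightarrow> 'a list \<Rightarrow> 'b" where
  "apex k \<rho> \<equiv> pick k (U k \<rho>)"

primrec C :: "nat \<Rightarrow> 'a list \<Rightarrow> 'b list \<Rightarrow> bit" where
  "C 0 \<tau> ys = meet \<tau> (map f ys)"
| "C (Suc k) \<tau> ys = meet \<tau> (map f ys) + bd (\<lambda>\<rho>. C k \<rho> (apex k \<rho> # ys)) \<tau>"

lemma tuples_Cons: "k \<le> Suc m \<Longrightarrow> tuples k = set_Cons (P k) (tuples (Suc k))"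
  unfolding tuples_def by (subst upt_conv_Cons) auto

lemma tuples_last [simp]: "tuples (Suc (Suc m)) = {[]}"
  by (simp add: tuples_def)

lemma finite_tuples: "finite (tuples k)"
proof (cases "k \<le> Suc (Suc m)")
  case True
  then show ?thesis
    by (induction k rule: inc_induct) (auto simp: tuples_Cons finite_set_Cons fin)
qed (simp add: tuples_def)

lemma Cons_in_tuples [simp]:
  "k \<le> Suc m \<Longrightarrow> x # ys \<in> tuples k \<longleftrightarrow> x \<in> P k \<and> ys \<in> tuples (Suc k)"
  by (simp add: tuples_Cons set_Cons_def)

lemma colours_from_Suc: "k \<le> Suc m \<Longrightarrow> colours_from k = P k \<union> colours_from (Suc k)"
proof -
  assume "k \<le> Suc m"
  then have "{k..Suc m} = insert k {Suc k..Suc m}" by auto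
  then show ?thesis by (simp add: colours_from_def)
qed

lemma colour_not_later: "k \<le> Suc m \<Longrightarrow> x \<in> P k \<Longrightarrow> x \<notin> colours_from (Suc k)"
proof
  assume k: "k \<le> Suc m" "x \<in> P k" and "x \<in> colours_from (Suc k)"
  then obtain j where "Suc k \<le> j" "j \<le> Suc m" "x \<in> P j" by (auto simp: colours_from_def)
  with k disjoint_family_onD[OF disj, of k j] show False by auto
qed

lemma disjoint_last: "x \<in> P m \<Longrightarrow> x \<notin> P (Suc m)"
  using disj[unfolded disjoint_family_on_def, rule_format, of m "Suc m"] by auto

lemma set_tuples: "k \<le> Suc (Suc m) \<Longrightarrow> ys \<in> tuples k \<Longrightarrow> set ys \<subseteq> colours_from k"
proof (induction k arbitrary: ys rule: inc_induct)
  case base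
  then show ?case by simp
next
  case (step k)
  then obtain x zs where "ys = x # zs" "x \<in> P k" "zs \<in> tuples (Suc k)"
    by (auto simp: tuples_Cons[of k] set_Cons_def)
  with step.IH[of zs] step.hyps colours_from_Suc[of k] show ?case by auto
qed

lemma colours_from_subset: "colours_from k \<subseteq> (\<Union>i\<le>Suc m. P i)"
  by (auto simp: colours_from_def)

text \<open>Averaging: the slices at the \<open>n\<close> points of \<open>P k\<close> have total
  size \<open>card U'\<close>.\<close>

lemma pick:
  assumes k: "k \<le> Suc m" and U: "U' \<subseteq> tuples k"
  shows "pick k U' \<in> P k" "n * card (slice (pick k U') U') \<le> card U'"
proof -
  have "finite U'" using U finite_tuples finite_subset by blast
  then have sum: "(\<Sum>x\<in>P k. card (slice x U')) = card U'"
    using card_slices[OF fin[OF k]] U by (simp add: tuples_Cons[OF k])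
  have "\<exists>x. x \<in> P k \<and> n * card (slice x U') \<le> card U'"
  proof (rule ccontr)
    assume "\<not> ?thesis"
    then have "(\<Sum>x\<in>P k. card U') < (\<Sum>x\<in>P k. n * card (slice x U'))"
      using fin[OF k] card[OF k] n by (intro sum_strict_mono) (auto simp: not_le)
    then show False by (simp add: card[OF k] sum flip: sum_distrib_left)
  qed
  from someI_ex[OF this] show "pick k U' \<in> P k" "n * card (slice (pick k U') U') \<le> card U'"
    unfolding pick_def by blast+
qed

lemma U_subset: "k \<le> Suc m \<Longrightarrow> U k \<tau> \<subseteq> tuples k"
proof (induction k arbitrary: \<tau>)
  case 0
  then show ?case by (auto simp: near_def)
next
  case (Suc k)
  then have "slice x (U k \<rho>) \<subseteq> tuples (Suc k)" for x \<rho>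
    by (fastforce simp: slice_def)
  then show ?case by auto
qed

lemma apex_in: "k \<le> Suc m \<Longrightarrow> apex k \<tau> \<in> P k"
  using pick U_subset by blast

text \<open>Prepending an apex enlarges the hull, so closeness to \<open>v\<close> is inherited by
  the longer tuple on a facet through \<open>v\<close>. This is why intersections with
  \<open>\<tau>\<close> cost nothing extra.\<close>

lemma U_near:
  assumes "v \<in> set \<tau>" "length \<tau> = Suc k" "k \<le> Suc m" "ys \<in> tuples k"
    "convex hull (f ` set ys) \<inter> cball v \<delta> \<noteq> {}"
  shows "ys \<in> U k \<tau>"
  using assms
proof (induction k arbitrary: \<tau> ys)
  case 0
  then have "\<tau> = [v]" by (cases \<tau>) auto
  with 0 show ?case by (simp add: near_def)
next
  case (Suc k)
  obtain \<rho> where \<rho>: "\<rho> \<in> set (faces \<tau>)" "v \<in> set \<rho>"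
    using face_containing[of v \<tau>] Suc.prems by auto
  have "apex k \<rho> # ys \<in> U k \<rho>"
  proof (rule Suc.IH)
    show "length \<rho> = Suc k" using length_faces[OF \<rho>(1)] Suc.prems by simp
    show "apex k \<rho> # ys \<in> tuples k" using Suc.prems apex_in by simp
    have "convex hull (f ` set ys) \<subseteq> convex hull (f ` set (apex k \<rho> # ys))"
      by (intro hull_mono) auto
    with Suc.prems(5) show "convex hull (f ` set (apex k \<rho> # ys)) \<inter> cball v \<delta> \<noteq> {}" by blast
  qed (use \<rho> Suc.prems in auto)
  with \<rho>(1) show ?case by (auto simp: slice_def)
qed

definition small :: "'a list \<Rightarrow> bool" where
  "small \<tau> \<longleftrightarrow> (\<forall>p\<in>set \<tau>. \<forall>q\<in>set \<tau>. dist p q \<le> \<delta>)"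

lemma small_face: "small \<tau> \<Longrightarrow> \<rho> \<in> set (faces \<tau>) \<Longrightarrow> small \<rho>"
  using set_faces unfolding small_def by blast

lemma small_hull: "small \<tau> \<Longrightarrow> v \<in> set \<tau> \<Longrightarrow> convex hull (set \<tau>) \<subseteq> cball v \<delta>"
  by (intro hull_minimal) (auto simp: small_def)

text \<open>A nonzero value comes from \<open>meet\<close>, which \<open>U_near\<close> absorbs as
  \<open>\<tau>\<close> is small, or from the filling on some facet, whose slice is part of
  \<open>U\<close>.\<close>

lemma C_support:
  assumes "length \<tau> = Suc k" "k \<le> Suc m" "small \<tau>" "ys \<in> tuples k" "C k \<tau> ys \<noteq> 0"
  shows "ys \<in> U k \<tau>"
proof -
  have meet: "ys \<in> U k \<tau>" if "meet \<tau> (map f ys) \<noteq> 0"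
  proof -
    have v: "hd \<tau> \<in> set \<tau>" using assms(1) by (cases \<tau>) auto
    show ?thesis
      using that small_hull[OF assms(3) v] by (intro U_near[OF v assms(1,2,4)]) (auto simp: meet_def)
  qed
  show ?thesis
    using assms meet
  proof (induction k arbitrary: \<tau> ys)
    case (Suc k)
    show ?case
    proof (cases "meet \<tau> (map f ys) = 0")
      case True
      then have "bd (\<lambda>\<rho>. C k \<rho> (apex k \<rho> # ys)) \<tau> = 1" using Suc.prems(5) by simp
      then obtain \<rho> where \<rho>: "\<rho> \<in> set (faces \<tau>)" "C k \<rho> (apex k \<rho> # ys) = 1"
        using bd_eq_1D by blast
      have "hd \<rho> \<in> set \<rho>" using length_faces[OF \<rho>(1)] Suc.prems(1) by (cases \<rho>) auto
      have "apex k \<rho> # ys \<in> U k \<rho>"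
      proof (rule Suc.IH)
        show "length \<rho> = Suc k" using length_faces[OF \<rho>(1)] Suc.prems by simp
        show "apex k \<rho> # ys \<in> tuples k" using Suc.prems apex_in by simp
        show "small \<rho>" using small_face \<rho>(1) Suc.prems by blast
        then show "apex k \<rho> # ys \<in> U k \<rho>" if "meet \<rho> (map f (apex k \<rho> # ys)) \<noteq> 0"
          using that small_hull[OF _ \<open>hd \<rho> \<in> set \<rho>\<close>] \<open>length \<rho> = Suc k\<close> \<open>apex k \<rho> # ys \<in> tuples k\<close> Suc.prems(2)
          by (intro U_near[OF \<open>hd \<rho> \<in> set \<rho>\<close>]) (auto simp: meet_def)
      qed (use \<rho> Suc.prems in auto)
      with \<rho>(1) show ?thesis by (auto simp: slice_def)
    qed (use Suc.prems in blast)
  qed simp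
qed

lemma U_far:
  assumes "length \<tau> = Suc k" "\<And>v. v \<in> set \<tau> \<Longrightarrow> near v = {}"
  shows "U k \<tau> = {}"
  using assms
proof (induction k arbitrary: \<tau>)
  case 0
  then show ?case by (cases \<tau>) auto
next
  case (Suc k)
  have "U k \<rho> = {}" if "\<rho> \<in> set (faces \<tau>)" for \<rho>
    using that length_faces[OF that] set_faces[OF that] Suc.prems by (intro Suc.IH) auto
  then show ?case by (auto simp: slice_def)
qed

text \<open>Passing to a slice gains a factor \<open>n\<close>, and the union over at most
  \<open>k + 2\<close> facets turns \<open>fact (Suc k)\<close> into
  \<open>fact (Suc (Suc k))\<close>.\<close>

lemma card_U:
  assumes near: "\<And>v. real (card (near v)) < c * real n ^ Suc (Suc m)"
    and "length \<tau> = Suc k" "k \<le> Suc m"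
  shows "real (card (U k \<tau>)) < fact (Suc k) * c * real n ^ (Suc (Suc m) - k)"
  using assms(2,3)
proof (induction k arbitrary: \<tau>)
  case 0
  then show ?case using near by simp
next
  case (Suc k)
  let ?B = "fact (Suc k) * c * real n ^ (Suc m - k)"
  have slice: "real (card (slice (apex k \<rho>) (U k \<rho>))) < ?B" if \<rho>: "\<rho> \<in> set (faces \<tau>)" for \<rho>
  proof -
    have "real n * real (card (slice (apex k \<rho>) (U k \<rho>))) \<le> real (card (U k \<rho>))"
      using pick(2)[of k, OF _ U_subset] Suc.prems(2) by (simp flip: of_nat_mult)
    also have "\<dots> < fact (Suc k) * c * real n ^ (Suc (Suc m) - k)"
      using length_faces[OF \<rho>] Suc.prems by (intro Suc.IH) auto
    also have "\<dots> = real n * ?B"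
      using Suc.prems(2) by (simp add: Suc_diff_le)
    finally show ?thesis using n by simp
  qed
  have "faces \<tau> \<noteq> []" using Suc.prems(1) by (cases \<tau>) auto
  then have ne: "card (set (faces \<tau>)) > 0" by (simp add: card_gt_0_iff)
  obtain \<rho> where "\<rho> \<in> set (faces \<tau>)" using \<open>faces \<tau> \<noteq> []\<close> hd_in_set by blast
  then have B: "?B > 0" using slice[of \<rho>] by (smt (verit) of_nat_0_le_iff)
  have "real (card (U (Suc k) \<tau>)) \<le> (\<Sum>\<rho>\<in>set (faces \<tau>). real (card (slice (apex k \<rho>) (U k \<rho>))))"
    using card_UN_le[of "set (faces \<tau>)" "\<lambda>\<rho>. slice (apex k \<rho>) (U k \<rho>)"] by (simp flip: of_nat_sum)
  also have "\<dots> < real (card (set (faces \<tau>))) * ?B"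
    using slice ne by (intro sum_bounded_above_strict)
  also have "\<dots> \<le> real (Suc (Suc k)) * ?B"
    using B card_length[of "faces \<tau>"] Suc.prems(1) by (intro mult_right_mono) auto
  finally show ?case by (simp add: algebra_simps)
qed

text \<open>The fillings in \<open>C k\<close> are boundaries in the simplex variable, so summing
  over the facets of \<open>\<tau>\<close> kills them by \<open>bd_bd\<close> and leaves the
  identity for \<open>meet\<close>.\<close>

lemma boundary_C:
  assumes "length \<tau> = Suc (Suc k)" "set \<tau> \<subseteq> D" "distinct ys" "set ys \<subseteq> (\<Union>i\<le>Suc m. P i)"
    "length ys + k = Suc (Suc m)"
  shows "bd (\<lambda>zs. meet \<tau> (map f zs)) ys + bd (\<lambda>\<rho>. C k \<rho> ys) \<tau> = 0"
proof -
  have "bd (\<lambda>\<rho>. C k \<rho> ys) \<tau> = bd (\<lambda>\<rho>. meet \<rho> (map f ys)) \<tau>"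
    by (cases k) (simp_all add: bd_add)
  then show ?thesis
    using general_position_meet_parity[OF gp assms(2-4)] assms(1,5) dim by simp
qed

text \<open>The cocycle condition at \<open>apex k \<rho> # ys\<close> says that coning fills
  \<open>C k \<rho>\<close>; the coboundary of the fillings then equals the sum treated in
  \<open>boundary_C\<close>. The list \<open>ys\<close> may repeat colours as long as its points are
  distinct, which is used for the last two colours.\<close>

lemma cocycle_C:
  assumes "length \<tau> = Suc k" "k \<le> Suc m" "set \<tau> \<subseteq> D" "distinct ys" "set ys \<subseteq> colours_from k"
    "length ys + k = Suc (Suc (Suc m))"
  shows "bd (C k \<tau>) ys = 0"
  using assms
proof (induction k arbitrary: \<tau> ys)
  case 0
  then obtain v where v: "\<tau> = [v]" by (cases \<tau>) auto
  have "bd (\<lambda>zs. meet \<tau> (map f zs)) ys + bd (\<lambda>\<rho>. meet \<rho> (map f ys)) \<tau> = 0"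
    using 0 colours_from_subset[of 0] dim by (intro general_position_meet_parity[OF gp]) auto
  moreover have "bd (\<lambda>\<rho>. meet \<rho> (map f ys)) \<tau> = 0" by (simp add: v bd_Cons meet_def)
  moreover have "C 0 \<tau> = (\<lambda>zs. meet \<tau> (map f zs))" by auto
  ultimately show ?case by simp
next
  case (Suc k)
  have "C k \<rho> ys + bd (\<lambda>zs. C k \<rho> (apex k \<rho> # zs)) ys = 0" if \<rho>: "\<rho> \<in> set (faces \<tau>)" for \<rho>
  proof -
    have "bd (C k \<rho>) (apex k \<rho> # ys) = 0"
    proof (rule Suc.IH)
      show "distinct (apex k \<rho> # ys)"
        using Suc.prems colour_not_later[of k "apex k \<rho>"] apex_in[of k \<rho>] by auto
      show "set (apex k \<rho> # ys) \<subseteq> colours_from k"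
        using Suc.prems apex_in[of k \<rho>] by (auto simp: colours_from_Suc[of k])
    qed (use Suc.prems length_faces[OF \<rho>] set_faces[OF \<rho>] in auto)
    then show ?thesis by (simp add: bd_Cons)
  qed
  then have filled: "bd (\<lambda>\<rho>. C k \<rho> ys) \<tau> = bd (\<lambda>\<rho>. bd (\<lambda>zs. C k \<rho> (apex k \<rho> # zs)) ys) \<tau>"
    by (intro bd_cong) (auto simp: bit_add_eq_0_iff)
  have "C (Suc k) \<tau> = (\<lambda>ys. meet \<tau> (map f ys) + bd (\<lambda>\<rho>. C k \<rho> (apex k \<rho> # ys)) \<tau>)" by auto
  then have "bd (C (Suc k) \<tau>) ys =
      bd (\<lambda>zs. meet \<tau> (map f zs)) ys + bd (\<lambda>zs. bd (\<lambda>\<rho>. C k \<rho> (apex k \<rho> # zs)) \<tau>) ys"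
    by (simp add: bd_add)
  also have "\<dots> = bd (\<lambda>zs. meet \<tau> (map f zs)) ys + bd (\<lambda>\<rho>. C k \<rho> ys) \<tau>"
    unfolding filled by (simp only: bd_swap[of _ ys \<tau>])
  also have "\<dots> = 0"
    using Suc.prems colours_from_subset[of "Suc k"] by (intro boundary_C) auto
  finally show ?case .
qed

end

section \<open>The last two colours and the contradiction\<close>

locale shallow_colour_classes = colour_classes m n P f D \<delta>
  for m n :: nat and P :: "nat \<Rightarrow> 'b set" and f :: "'b \<Rightarrow> 'a::euclidean_space"
    and D :: "'a set" and \<delta> :: real +
  assumes near: "\<And>v. real (card (near v)) <
      2 * real (Suc m) / (real (Suc (Suc m)) * fact (Suc (Suc m))) * real n ^ Suc (Suc m)"
    and \<delta>: "\<delta> > 0"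
begin

text \<open>The pairs in exactly one of the cylinders over \<open>A\<close> and \<open>B\<close>
  belong to \<open>U m \<tau>\<close>, and \<open>card_U\<close> at \<open>k = m\<close> contributes
  the factor \<open>fact (Suc m)\<close>, which leaves \<open>2 d / (d + 1)^2\<close> with
  \<open>d = Suc m\<close>.\<close>

lemma cylinder_bound:
  assumes \<tau>: "length \<tau> = Suc m" and AB: "A \<subseteq> P m" "B \<subseteq> P (Suc m)"
    and sub: "\<And>x y. x \<in> P m \<Longrightarrow> y \<in> P (Suc m) \<Longrightarrow> (x \<in> A) \<noteq> (y \<in> B) \<Longrightarrow> [x, y] \<in> U m \<tau>"
  shows "real (card A) * (real n - real (card B)) + (real n - real (card A)) * real (card B)
           < 2 * real (Suc m) / (real (Suc m) + 1)\<^sup>2 * (real n)\<^sup>2"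
proof -
  let ?S = "A \<times> (P (Suc m) - B) \<union> (P m - A) \<times> B"
  have finP: "finite (P m)" "finite (P (Suc m))" using fin by auto
  then have finAB: "finite A" "finite B" using AB finite_subset by auto
  have "card ?S = card (A \<times> (P (Suc m) - B)) + card ((P m - A) \<times> B)"
    using finP finAB by (intro card_Un_disjoint) auto
  then have S: "card ?S = card A * (n - card B) + (n - card A) * card B"
    using finP finAB AB card[of m] card[of "Suc m"] by (simp add: card_cartesian_product card_Diff_subset)
  have le: "card A \<le> n" "card B \<le> n"
    using card_mono[OF finP(1) AB(1)] card_mono[OF finP(2) AB(2)] card[of m] card[of "Suc m"] by auto
  have "card ?S = card ((\<lambda>(x, y). [x, y]) ` ?S)"
    by (intro card_image[symmetric] inj_onI) auto
  also have "\<dots> \<le> card (U m \<tau>)"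
    using AB sub finite_subset[OF U_subset[of m \<tau>] finite_tuples]
    by (intro card_mono) (auto simp: subset_iff)
  finally have le_U: "card ?S \<le> card (U m \<tau>)" .
  have "real (card A) * (real n - real (card B)) + (real n - real (card A)) * real (card B) = real (card ?S)"
    unfolding S using le by (simp add: of_nat_diff)
  also have "\<dots> \<le> real (card (U m \<tau>))" using le_U by (simp only: of_nat_le_iff)
  also have "\<dots> < fact (Suc m) * (2 * real (Suc m) / (real (Suc (Suc m)) * fact (Suc (Suc m)))) * real n ^ (Suc (Suc m) - m)"
    by (rule card_U[OF near \<tau>]) simp
  also have "\<dots> = 2 * real (Suc m) / (real (Suc m) + 1)\<^sup>2 * (real n)\<^sup>2"
  proof -
    have "fact (Suc (Suc m)) = (real (Suc m) + 1) * fact (Suc m)" by (simp add: algebra_simps)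
    moreover have "Suc (Suc m) - m = 2" by simp
    moreover have "F * (2 * x / ((x + 1) * ((x + 1) * F))) = 2 * x / (x + 1)\<^sup>2" if "F \<noteq> 0" for F x :: real
      using that by (simp add: power2_eq_square)
    note this[OF fact_nonzero[of "Suc m"], of "real (Suc m)"]
    ultimately show ?thesis by (simp only: of_nat_Suc[of "Suc m"] add.commute[of 1])
  qed
  finally show ?thesis .
qed

text \<open>\<open>G\<close> is a potential of the cocycle \<open>C m \<tau>\<close>, determined up
  to adding 1; the bounds by one half select one of the two potentials.\<close>

definition splits :: "'a list \<Rightarrow> ('b \<Rightarrow> bit) \<Rightarrow> bool" where
  "splits \<tau> G \<longleftrightarrow> (\<forall>x\<in>P m. \<forall>y\<in>P (Suc m). C m \<tau> [x, y] = G x + G y) \<and>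
     2 * real (card {x \<in> P m. G x = 1}) < real n \<and> 2 * real (card {y \<in> P (Suc m). G y = 1}) < real n"

lemma exists_splits:
  assumes \<tau>: "length \<tau> = Suc m" "set \<tau> \<subseteq> D" "small \<tau>"
  shows "\<exists>G. splits \<tau> G"
proof -
  have "P m \<noteq> {}" using card[of m] n by auto
  then obtain a where a: "a \<in> P m" by blast
  \<comment> \<open>The value at \<open>a\<close> is set separately because the cocycle condition
    requires distinct points; 0 makes the splitting hold trivially for pairs starting with
    \<open>a\<close>.\<close>
  define G where "G = (\<lambda>x. if x = a then 0 else C m \<tau> [a, x])"
  have P: "x \<noteq> y" if "x \<in> P m" "y \<in> P (Suc m)" for x y
    using disjoint_last that by auto
  have G: "C m \<tau> [x, y] = G x + G y" if xy: "x \<in> P m" "y \<in> P (Suc m)" for x y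
  proof (cases "x = a")
    case True
    then show ?thesis using P[OF xy] by (simp add: G_def)
  next
    case False
    \<comment> \<open>Here \<open>a\<close> and \<open>x\<close> have the same colour: the cochain
      is also evaluated off the colourful tuples, where it has no support bound.\<close>
    have "bd (C m \<tau>) [a, x, y] = 0"
      using False a xy P[OF a xy(2)] P[OF xy] \<tau>
      by (intro cocycle_C) (auto simp: colours_from_def intro: bexI[of _ m] bexI[of _ "Suc m"])
    then show ?thesis
      using False P[OF a xy(2)] by (simp add: bd_Cons G_def bit_add_eq_0_iff add.commute)
  qed
  let ?a = "\<lambda>G. real (card {x \<in> P m. G x = (1::bit)})" and ?b = "\<lambda>G. real (card {y \<in> P (Suc m). G y = (1::bit)})"
  have U: "[x, y] \<in> U m \<tau>" if "x \<in> P m" "y \<in> P (Suc m)" "G x \<noteq> G y" for x y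
    using that G[OF that(1,2)] \<tau> by (intro C_support) (auto simp: bit_add_eq_0_iff simp del: bit_not_zero_iff)
  have "?a G * (real n - ?b G) + (real n - ?a G) * ?b G < 2 * real (Suc m) / (real (Suc m) + 1)\<^sup>2 * (real n)\<^sup>2"
    by (rule cylinder_bound[OF \<tau>(1)]) (use U in auto)
  then have "(real n - 2 * ?a G) * (real n - 2 * ?b G) > 0" by (rule same_half)
  then consider "2 * ?a G < n" "2 * ?b G < n" | "2 * ?a G > n" "2 * ?b G > n"
    by (auto simp: zero_less_mult_iff)
  then show ?thesis
  proof cases
    case 1
    with G show ?thesis unfolding splits_def by blast
  next
    case 2
    define G' where "G' = (\<lambda>x. G x + 1)"
    have "?a G + ?a G' = n" "?b G + ?b G' = n"
    proof -
      have *: "real (card {x \<in> P i. G x = 1}) + real (card {x \<in> P i. G' x = 1}) = n" if "i \<le> Suc m" for i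
      proof -
        have "P i = {x \<in> P i. G x = 1} \<union> {x \<in> P i. G' x = 1}" "{x \<in> P i. G x = 1} \<inter> {x \<in> P i. G' x = 1} = {}"
          by (auto simp: G'_def)
        then have "card (P i) = card {x \<in> P i. G x = 1} + card {x \<in> P i. G' x = 1}"
          using fin[OF that] by (metis (lifting) card_Un_disjoint finite_Un)
        then show ?thesis by (simp add: card[OF that])
      qed
      show "?a G + ?a G' = n" "?b G + ?b G' = n" using * by auto
    qed
    moreover have "G' x + G' y = G x + G y" for x y by (cases "G x"; cases "G y") (auto simp: G'_def)
    ultimately show ?thesis using 2 G unfolding splits_def by (intro exI[of _ G']) auto
  qed
qed

definition G :: "'a list \<Rightarrow> 'b \<Rightarrow> bit" where
  "G \<tau> = (SOME G. splits \<tau> G)"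

lemma splits_G: "length \<tau> = Suc m \<Longrightarrow> set \<tau> \<subseteq> D \<Longrightarrow> small \<tau> \<Longrightarrow> splits \<tau> (G \<tau>)"
  unfolding G_def by (rule someI_ex[of "splits \<tau>", OF exists_splits])

text \<open>\<open>C m \<tau>\<close> vanishes there, so \<open>G \<tau>\<close> is constant on the
  last two colours; the value 1 would fill all of \<open>P m\<close>, more than half.\<close>

lemma G_far:
  assumes "length \<tau> = Suc m" "set \<tau> \<subseteq> D" "small \<tau>" "\<And>v. v \<in> set \<tau> \<Longrightarrow> near v = {}"
    and x: "x \<in> P (Suc m)"
  shows "G \<tau> x = 0"
proof (rule ccontr)
  assume "G \<tau> x \<noteq> 0"
  have sp: "splits \<tau> (G \<tau>)" using assms by (intro splits_G)
  have "G \<tau> y = 1" if y: "y \<in> P m" for y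
  proof -
    have "C m \<tau> [y, x] = 0"
      using C_support[of \<tau> m "[y, x]"] U_far[of \<tau> m] assms y by (cases "C m \<tau> [y, x]") auto
    then show ?thesis using sp y x \<open>G \<tau> x \<noteq> 0\<close> by (auto simp: splits_def bit_add_eq_0_iff)
  qed
  then have "{y \<in> P m. G \<tau> y = 1} = P m" by auto
  then show False using sp card[of m] by (simp add: splits_def)
qed

text \<open>Adding to the sets cut out by \<open>G \<tau>\<close> the points that lie in the small simplex \<open>\<sigma>\<close> does
  not spoil the bound, because all pairs through such points already belong to \<open>U m \<tau>\<close>.\<close>

lemma card_covered_less:
  assumes \<tau>: "length \<tau> = Suc m" "set \<tau> \<subseteq> D" "small \<tau>" and v: "v \<in> set \<tau>"
    and Z: "\<And>x. x \<in> Z \<Longrightarrow> f x \<in> cball v \<delta>"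
  shows "(real (Suc m) + 1) * (real (card {x \<in> P m. G \<tau> x = 1 \<or> x \<in> Z}) +
            real (card {x \<in> P (Suc m). G \<tau> x = 1 \<or> x \<in> Z})) < 2 * real n"
proof -
  have sp: "splits \<tau> (G \<tau>)" using \<tau> by (rule splits_G)
  have U: "[x, y] \<in> U m \<tau>" if xy: "x \<in> P m" "y \<in> P (Suc m)" and "x \<in> Z \<or> y \<in> Z \<or> G \<tau> x \<noteq> G \<tau> y" for x y
  proof (cases "x \<in> Z \<or> y \<in> Z")
    case True
    then obtain z where z: "z \<in> {x, y}" "f z \<in> cball v \<delta>" using Z by auto
    moreover have "f z \<in> convex hull (f ` set [x, y])" using z(1) by (intro hull_inc) auto
    ultimately have "convex hull (f ` set [x, y]) \<inter> cball v \<delta> \<noteq> {}" by blast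
    then show ?thesis using \<tau>(1) xy by (intro U_near[OF v]) auto
  next
    case False
    then have "C m \<tau> [x, y] \<noteq> 0"
      using that sp by (auto simp: splits_def bit_add_eq_0_iff simp del: bit_not_zero_iff)
    then show ?thesis using \<tau> xy by (intro C_support) auto
  qed
  let ?Am = "{x \<in> P m. G \<tau> x = 1}" and ?Bm = "{x \<in> P (Suc m). G \<tau> x = 1}"
  let ?A = "{x \<in> P m. G \<tau> x = 1 \<or> x \<in> Z}" and ?B = "{x \<in> P (Suc m). G \<tau> x = 1 \<or> x \<in> Z}"
  have half: "2 * real (card ?Am) < n" "2 * real (card ?Bm) < n" using sp by (auto simp: splits_def)
  \<comment> \<open>The sets are enlarged one after the other: one factor is known to be positive,
    so the sign of the product shows that the enlarged set is still below half.\<close>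
  have "(real n - 2 * real (card ?A)) * (real n - 2 * real (card ?Bm)) > 0"
    by (rule same_half, rule cylinder_bound[OF \<tau>(1)]) (blast, blast, rule U, auto)
  then have A: "2 * real (card ?A) < n" using half by (auto simp: zero_less_mult_iff)
  have AB: "real (card ?A) * (real n - real (card ?B)) + (real n - real (card ?A)) * real (card ?B)
           < 2 * real (Suc m) / (real (Suc m) + 1)\<^sup>2 * (real n)\<^sup>2"
    by (rule cylinder_bound[OF \<tau>(1)]) (blast, blast, rule U, auto)
  then have "(real n - 2 * real (card ?A)) * (real n - 2 * real (card ?B)) > 0" by (rule same_half)
  then have B: "2 * real (card ?B) < n" using A by (auto simp: zero_less_mult_iff)
  show ?thesis by (rule sum_densities_less[OF _ AB A B]) (use n in auto)
qed

text \<open>By \<open>boundary_C\<close>, \<open>H\<close> agrees on points of the two last colours,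
  so it is constant. If it were 1, every such point would lie in \<open>\<sigma>\<close> or have
  \<open>G \<tau> x = 1\<close> for some facet, and the at most \<open>d + 1\<close> facets would
  cover \<open>2 n\<close> points with less than \<open>2 n / (d + 1)\<close> each, where
  \<open>d = Suc m\<close>.\<close>

lemma top_cochain_eq_0:
  assumes \<sigma>: "length \<sigma> = Suc (Suc m)" "set \<sigma> \<subseteq> D" "small \<sigma>" and x: "x \<in> P (Suc m)"
  shows "meet \<sigma> [f x] + bd (\<lambda>\<tau>. G \<tau> x) \<sigma> = 0"
proof (rule ccontr)
  define H where "H = (\<lambda>x. meet \<sigma> [f x] + bd (\<lambda>\<tau>. G \<tau> x) \<sigma>)"
  assume "meet \<sigma> [f x] + bd (\<lambda>\<tau>. G \<tau> x) \<sigma> \<noteq> 0"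
  then have Hx: "H x = 1" by (simp add: H_def)
  have face: "length \<tau> = Suc m" "set \<tau> \<subseteq> D" "small \<tau>" if "\<tau> \<in> set (faces \<sigma>)" for \<tau>
    using that length_faces[OF that] set_faces[OF that] small_face[OF \<sigma>(3) that] \<sigma> by auto
  have H: "H y + H z = 0" if yz: "y \<in> P m" "z \<in> P (Suc m)" for y z
  proof -
    have "y \<noteq> z" using disjoint_last yz by auto
    then have "bd (\<lambda>zs. meet \<sigma> (map f zs)) [y, z] + bd (\<lambda>\<rho>. C m \<rho> [y, z]) \<sigma> = 0"
      using \<sigma> yz by (intro boundary_C) (auto intro: bexI[of _ m] bexI[of _ "Suc m"])
    moreover have "bd (\<lambda>\<rho>. C m \<rho> [y, z]) \<sigma> = bd (\<lambda>\<rho>. G \<rho> y + G \<rho> z) \<sigma>"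
      using splits_G[OF face] yz by (intro bd_cong) (auto simp: splits_def)
    ultimately show ?thesis by (simp add: H_def bd_Cons bd_add ac_simps)
  qed
  have H1: "H y = 1" if "y \<in> P m \<union> P (Suc m)" for y
  proof -
    have m: "H y = 1" if "y \<in> P m" for y using H[OF that x] Hx by (simp add: bit_add_eq_0_iff)
    obtain y0 where "y0 \<in> P m" using card[of m] n by fastforce
    with H[of y0] m that show ?thesis by (auto simp: bit_add_eq_0_iff)
  qed
  define Z where "Z = {x. f x \<in> convex hull (set \<sigma>)}"
  define A where "A = (\<lambda>i \<tau>. {x \<in> P i. G \<tau> x = 1 \<or> x \<in> Z})"
  have ne: "set (faces \<sigma>) \<noteq> {}" using \<sigma>(1) by (cases \<sigma>) auto
  have cover: "real n \<le> (\<Sum>\<tau>\<in>set (faces \<sigma>). real (card (A i \<tau>)))" if i: "i \<in> {m, Suc m}" for i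
  proof -
    have "P i \<subseteq> (\<Union>\<tau>\<in>set (faces \<sigma>). A i \<tau>)"
    proof
      fix y assume y: "y \<in> P i"
      show "y \<in> (\<Union>\<tau>\<in>set (faces \<sigma>). A i \<tau>)"
      proof (cases "y \<in> Z")
        case True
        obtain \<tau> where "\<tau> \<in> set (faces \<sigma>)" using ne by (meson ex_in_conv)
        with True y show ?thesis by (auto simp: A_def)
      next
        case False
        then have "bd (\<lambda>\<tau>. G \<tau> y) \<sigma> = 1"
          using H1[of y] y i by (auto simp: H_def Z_def meet_def)
        then show ?thesis using bd_eq_1D y by (fastforce simp: A_def)
      qed
    qed
    then have "card (P i) \<le> card (\<Union>\<tau>\<in>set (faces \<sigma>). A i \<tau>)"
      using fin[of i] i by (intro card_mono) (auto simp: A_def)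
    also have "\<dots> \<le> (\<Sum>\<tau>\<in>set (faces \<sigma>). card (A i \<tau>))" by (intro card_UN_le) auto
    finally have "real (card (P i)) \<le> real (\<Sum>\<tau>\<in>set (faces \<sigma>). card (A i \<tau>))" by (simp only: of_nat_le_iff)
    then show ?thesis using card[of i] i by auto
  qed
  have less: "real (card (A m \<tau>)) + real (card (A (Suc m) \<tau>)) < 2 * real n / (real (Suc m) + 1)"
    if \<tau>: "\<tau> \<in> set (faces \<sigma>)" for \<tau>
  proof -
    have v: "hd \<tau> \<in> set \<tau>" using face(1)[OF \<tau>] by (cases \<tau>) auto
    then have "hd \<tau> \<in> set \<sigma>" using set_faces[OF \<tau>] by blast
    then have "f x \<in> cball (hd \<tau>) \<delta>" if "x \<in> Z" for x
      using that small_hull[OF \<sigma>(3)] unfolding Z_def by blast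
    from card_covered_less[OF face[OF \<tau>] v this] show ?thesis
      by (simp add: A_def less_divide_eq mult.commute)
  qed
  have "2 * real n \<le> (\<Sum>\<tau>\<in>set (faces \<sigma>). real (card (A m \<tau>)) + real (card (A (Suc m) \<tau>)))"
    using cover[of m] cover[of "Suc m"] by (simp add: sum.distrib)
  also have "\<dots> < real (card (set (faces \<sigma>))) * (2 * real n / (real (Suc m) + 1))"
    using less ne by (intro sum_bounded_above_strict) (auto simp: card_gt_0_iff)
  also have "\<dots> \<le> (real (Suc m) + 1) * (2 * real n / (real (Suc m) + 1))"
    using card_length[of "faces \<sigma>"] \<sigma>(1) by (intro mult_right_mono) auto
  also have "\<dots> = 2 * real n" by (simp add: add_eq_0_iff_both_eq_0)
  finally show False by simp
qed

text \<open>Evaluation at a single point \<open>x\<close> suffices. The terms in \<open>G\<close>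
  reduce by \<open>sdn_chain_map\<close> to the subdivided facets of \<open>\<Delta>\<close>, which
  are so far out that \<open>G_far\<close> applies, while the terms in \<open>meet\<close> add up to
  \<open>meet \<Delta> [f x] = 1\<close>.\<close>

lemma no_shallow_colour_classes:
  assumes D: "D = rational_points"
  shows False
proof -
  obtain x where x: "x \<in> P (Suc m)" using card[of "Suc m"] n by fastforce
  have "bounded (f ` (\<Union>i\<le>Suc m. P i))" using fin by (intro finite_imp_bounded) auto
  then obtain R where R: "R > 0" "\<And>x. x \<in> (\<Union>i\<le>Suc m. P i) \<Longrightarrow> norm (f x) \<le> R"
    unfolding bounded_pos by blast
  obtain \<Delta> :: "'a list" where \<Delta>: "length \<Delta> = Suc (Suc m)" "set \<Delta> \<subseteq> D" "cball 0 (R + \<delta>) \<subseteq> convex hull (set \<Delta>)"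
    "\<And>\<tau> v. \<tau> \<in> set (faces \<Delta>) \<Longrightarrow> v \<in> convex hull (set \<tau>) \<Longrightarrow> norm v > R + \<delta>"
    using exists_big_simplex[of "R + \<delta>", where 'a = 'a] R(1) \<delta> dim D by auto
  have far: "near v = {}" if "norm v > R + \<delta>" for v
  proof -
    have "convex hull (f ` set ys) \<subseteq> cball 0 R" if "ys \<in> tuples 0" for ys
      using set_tuples[OF _ that] colours_from_subset[of 0] R(2)
      by (intro hull_minimal) (auto simp: subset_iff)
    moreover have "cball 0 R \<inter> cball v \<delta> = {}"
      using that by (auto simp: dist_norm) (smt (verit) norm_triangle_sub)
    ultimately show ?thesis unfolding near_def by blast
  qed
  obtain N where N: "\<And>\<tau> \<rho> p q. set \<tau> \<subseteq> set \<Delta> \<Longrightarrow> length \<tau> \<le> length \<Delta> \<Longrightarrow> \<rho> \<in> set (sdn bary N \<tau>) \<Longrightarrow>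
      p \<in> set \<rho> \<Longrightarrow> q \<in> set \<rho> \<Longrightarrow> dist p q \<le> \<delta>"
    using exists_fine_subdivision[OF \<delta>, of \<Delta>] by meson
  have baryD: "bary ys \<in> D" if "set ys \<subseteq> D" for ys using that bary_rational_points D by blast
  have "(\<Sum>\<sigma>\<leftarrow>sdn bary N \<Delta>. meet \<sigma> [f x] + bd (\<lambda>\<tau>. G \<tau> x) \<sigma>) = (\<Sum>\<sigma>\<leftarrow>sdn bary N \<Delta>. 0)"
  proof (intro arg_cong[of _ _ sum_list] map_cong refl)
    fix \<sigma> assume \<sigma>: "\<sigma> \<in> set (sdn bary N \<Delta>)"
    show "meet \<sigma> [f x] + bd (\<lambda>\<tau>. G \<tau> x) \<sigma> = 0"
    proof (rule top_cochain_eq_0[OF _ _ _ x])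
      show "set \<sigma> \<subseteq> D" using set_sdn[OF baryD \<Delta>(2) \<sigma>] .
      show "small \<sigma>" unfolding small_def using N[OF _ _ \<sigma>] by auto
    qed (use \<Delta>(1) length_sdn[OF \<sigma>] in simp)
  qed
  moreover have "(\<Sum>\<sigma>\<leftarrow>sdn bary N \<Delta>. meet \<sigma> [f x]) = meet \<Delta> [f x]"
  proof (rule sdn_eval_cocycle[where D = D and n = "Suc (Suc m)"])
    fix \<rho> assume "length \<rho> = Suc (Suc (Suc m))" "set \<rho> \<subseteq> D"
    then have "bd (\<lambda>zs. meet \<rho> (map f zs)) [x] + bd (\<lambda>\<tau>. meet \<tau> (map f [x])) \<rho> = 0"
      using x dim by (intro general_position_meet_parity[OF gp]) auto
    then show "bd (\<lambda>\<tau>. meet \<tau> [f x]) \<rho> = 0" by (simp add: bd_Cons meet_def)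
  next
    fix \<rho> \<tau> assume \<tau>: "set \<tau> \<subseteq> D" "Suc (length \<tau>) = Suc (Suc m)" "set \<rho> \<subseteq> convex hull (set \<tau>)"
    \<comment> \<open>The at most \<open>DIM('a)\<close> vertices of \<open>\<tau>\<close> together
      with \<open>x\<close> are within the bound of general position, so a flattened simplex misses
      \<open>f x\<close>.\<close>
    have "card (set \<tau>) + card {x} \<le> DIM('a) + 1" using card_length[of \<tau>] \<tau>(2) dim by simp
    moreover have "{x} \<subseteq> (\<Union>i\<le>Suc m. P i)" using x by auto
    ultimately have "affine hull (set \<tau>) \<inter> affine hull (f ` {x}) = {}"
      using gp[unfolded general_position_def, rule_format, of "set \<tau>" "{x}"] \<tau>(1) by simp
    moreover have "convex hull (set \<rho>) \<subseteq> affine hull (set \<tau>)"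
      using \<tau>(3) hull_minimal[of "set \<rho>" "convex hull (set \<tau>)" convex] convex_hull_subset_affine_hull by blast
    ultimately show "meet \<rho> [f x] = 0" by (auto simp: meet_def)
  qed (use \<Delta> baryD in auto)
  moreover have "(\<Sum>\<sigma>\<leftarrow>sdn bary N \<Delta>. bd (\<lambda>\<tau>. G \<tau> x) \<sigma>) = 0"
    unfolding sdn_chain_map
  proof (rule bd_eq_0)
    fix \<tau> assume \<tau>: "\<tau> \<in> set (faces \<Delta>)"
    have "G \<rho> x = 0" if \<rho>: "\<rho> \<in> set (sdn bary N \<tau>)" for \<rho>
    proof (rule G_far[OF _ _ _ _ x])
      show "length \<rho> = Suc m" using length_sdn[OF \<rho>] length_faces[OF \<tau>] \<Delta>(1) by simp
      show "set \<rho> \<subseteq> D"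
        using set_sdn[OF baryD _ \<rho>] set_faces[OF \<tau>] \<Delta>(2) by blast
      show "small \<rho>"
        unfolding small_def using N[OF set_faces[OF \<tau>] _ \<rho>] length_faces_less[OF \<tau>] by auto
      show "near v = {}" if "v \<in> set \<rho>" for v
        using far \<Delta>(4)[OF \<tau>] set_sdn_bary[OF \<rho>] that by blast
    qed
    then show "(\<Sum>\<rho>\<leftarrow>sdn bary N \<tau>. G \<rho> x) = 0" by (simp cong: map_cong)
  qed
  moreover have "meet \<Delta> [f x] = 1"
    using \<Delta>(3) R(2)[of x] x \<delta> by (force simp: meet_def)
  ultimately show False by (simp add: sum_list_addf)
qed

end

section \<open>Return to the original points\<close>

lemma convex_hull_image_close:
  fixes g h :: "'i \<Rightarrow> 'a::real_normed_vector"
  assumes "finite I" "y \<in> convex hull (g ` I)" "\<And>i. i \<in> I \<Longrightarrow> dist (h i) (g i) \<le> e"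
  shows "\<exists>z\<in>convex hull (h ` I). dist z y \<le> e"
proof -
  obtain \<alpha> where \<alpha>: "\<forall>i\<in>I. \<alpha> i \<ge> 0" "sum \<alpha> I = 1" "(\<Sum>i\<in>I. \<alpha> i *\<^sub>R g i) = y"
    using assms(2) unfolding convex_hull_image_iff[OF assms(1)] by blast
  let ?z = "\<Sum>i\<in>I. \<alpha> i *\<^sub>R h i"
  have "?z \<in> convex hull (h ` I)"
    unfolding convex_hull_image_iff[OF assms(1)] using \<alpha>(1,2) by blast
  moreover have "dist ?z y \<le> e"
  proof -
    have "?z - y = (\<Sum>i\<in>I. \<alpha> i *\<^sub>R (h i - g i))"
      by (simp add: scaleR_diff_right sum_subtractf flip: \<alpha>(3))
    also have "norm \<dots> \<le> (\<Sum>i\<in>I. \<alpha> i * e)"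
      using \<alpha>(1) assms(3) by (intro sum_norm_le) (simp add: dist_norm mult_left_mono)
    also have "\<dots> = e" using \<alpha>(2) by (simp flip: sum_distrib_right)
    finally show ?thesis by (simp add: dist_norm)
  qed
  ultimately show ?thesis by blast
qed

lemma in_listset_iff: "xs \<in> listset As \<longleftrightarrow> list_all2 (\<in>) xs As"
  by (induction As arbitrary: xs) (auto simp: set_Cons_def list_all2_Cons2)

text \<open>The tolerance is shared: the points move by less than \<open>e / 2\<close> and
  \<open>\<delta>\<close> is \<open>e / 2\<close>, so a moved simplex within \<open>\<delta>\<close>
  of \<open>v\<close> comes from an original one within \<open>e\<close>. Lists of vertices are
  matched injectively with the extensional functions that are counted.\<close>

lemma exists_approximately_deep_point:
  fixes P :: "nat \<Rightarrow> 'a::euclidean_space set"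
  assumes dim: "DIM('a) = Suc m" and n: "n \<ge> 1" and disj: "disjoint_family_on P {..Suc m}"
    and fin: "\<And>i. i \<le> Suc m \<Longrightarrow> finite (P i)" and card: "\<And>i. i \<le> Suc m \<Longrightarrow> card (P i) = n"
    and e: "e > 0"
  shows "\<exists>p. 2 * real (Suc m) / (real (Suc (Suc m)) * fact (Suc (Suc m))) * real n ^ Suc (Suc m) \<le>
    real (card {w \<in> colorful_tuples (Suc m) P. \<exists>y\<in>colorful_simplex (Suc m) w. dist p y \<le> e})"
proof (rule ccontr)
  let ?N = "2 * real (Suc m) / (real (Suc (Suc m)) * fact (Suc (Suc m))) * real n ^ Suc (Suc m)"
  let ?S = "\<lambda>p. {w \<in> colorful_tuples (Suc m) P. \<exists>y\<in>colorful_simplex (Suc m) w. dist p y \<le> e}"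
  assume "\<not> ?thesis"
  then have less: "real (card (?S p)) < ?N" for p by (simp only: not_ex not_le)
  have Q: "finite (\<Union>i\<le>Suc m. P i)" using fin by auto
  obtain f where f: "\<forall>x\<in>(\<Union>i\<le>Suc m. P i). dist x (f x) < e / 2"
    and gp: "general_position rational_points f (\<Union>i\<le>Suc m. P i)"
    using exists_general_position[OF Q countable_rational_points half_gt_zero[OF e]] by blast
  interpret colour_classes m n P f rational_points "e / 2"
    by unfold_locales (use dim n disj fin card gp in auto)
  have "real (card (near v)) < ?N" for v
  proof -
    let ?g = "\<lambda>ys. \<lambda>i\<in>{..Suc m}. ys ! i"
    have tup: "length ys = Suc (Suc m) \<and> (\<forall>i\<le>Suc m. ys ! i \<in> P i)" if "ys \<in> tuples 0" for ys
      using that by (auto simp: tuples_def in_listset_iff list_all2_conv_all_nth less_Suc_eq_le simp del: upt_Suc)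
    have "inj_on ?g (near v)"
    proof (rule inj_onI)
      fix ys zs assume "ys \<in> near v" "zs \<in> near v" and eq: "?g ys = ?g zs"
      then have len: "length ys = Suc (Suc m)" "length zs = Suc (Suc m)" using tup by (auto simp: near_def)
      have "ys ! i = zs ! i" if "i \<le> Suc m" for i using fun_cong[OF eq, of i] that by simp
      then show "ys = zs" using len by (intro nth_equalityI) auto
    qed
    then have "card (near v) = card (?g ` near v)" by (rule card_image[symmetric])
    also have "\<dots> \<le> card (?S v)"
    proof (rule card_mono)
      have "finite (colorful_tuples (Suc m) P)"
        unfolding colorful_tuples_def using fin by (intro finite_PiE) auto
      then show "finite (?S v)" by simp
      show "?g ` near v \<subseteq> ?S v"
      proof safe
        fix ys assume ys: "ys \<in> near v"
        then have t: "length ys = Suc (Suc m)" "\<And>i. i \<le> Suc m \<Longrightarrow> ys ! i \<in> P i"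
          using tup by (auto simp: near_def)
        show "?g ys \<in> colorful_tuples (Suc m) P" using t(2) by (auto simp: colorful_tuples_def)
        have "set ys = (!) ys ` {..Suc m}"
          using t(1) nth_image[of "length ys" ys] by (simp add: lessThan_Suc_atMost flip: lessThan_atLeast0)
        then obtain y where y: "y \<in> convex hull ((\<lambda>i. f (ys ! i)) ` {..Suc m})" "dist v y \<le> e / 2"
          using ys unfolding near_def by (auto simp: image_image)
        have "dist (ys ! i) (f (ys ! i)) \<le> e / 2" if "i \<in> {..Suc m}" for i
          using f t(2)[of i] that by (intro less_imp_le) auto
        from convex_hull_image_close[OF _ y(1) this] obtain z
          where z: "z \<in> convex hull ((!) ys ` {..Suc m})" "dist z y \<le> e / 2" by auto
        have "?g ys ` {..Suc m} = (!) ys ` {..Suc m}" by auto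
        then have "z \<in> colorful_simplex (Suc m) (?g ys)" using z(1) by (simp only: colorful_simplex_def)
        moreover have "dist v z \<le> e" using dist_triangle_le[of v y z] y(2) z(2) dist_triangle2[of v z y] by simp
        ultimately show "\<exists>y\<in>colorful_simplex (Suc m) (?g ys). dist v y \<le> e" by blast
      qed
    qed
    finally show ?thesis using less[of v] by linarith
  qed
  then interpret shallow_colour_classes m n P f rational_points "e / 2"
    by unfold_locales (use e in auto)
  show False by (rule no_shallow_colour_classes) simp
qed

theorem corollary4:
  fixes d n :: nat and P :: "nat \<Rightarrow> (real ^ 'd::finite) set"
  assumes "CARD('d) = d" and "d \<ge> 1" and "n \<ge> 1"
    and "disjoint_family_on P {..d}"
    and "\<And>i. i \<le> d \<Longrightarrow> finite (P i)"
    and "\<And>i. i \<le> d \<Longrightarrow> card (P i) = n"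
  shows "\<exists>p :: real ^ 'd.
    real (num_colorful_simplices_containing d P p)
      \<ge> 2 * real d / (real (d + 1) * fact (d + 1)) * real n ^ (d + 1)"
proof -
  obtain m where d: "d = Suc m" using assms(2) by (cases d) auto
  have dim: "DIM(real ^ 'd) = Suc m" using assms(1) d by simp
  let ?N = "2 * real d / (real (d + 1) * fact (d + 1)) * real n ^ (d + 1)"
  have "\<exists>p. ?N \<le> real (card {w \<in> colorful_tuples d P. p \<in> colorful_simplex d w})"
  proof (rule exists_deep_point_of_approximate)
    show "finite (colorful_tuples d P)"
      unfolding colorful_tuples_def using assms(5) by (intro finite_PiE) auto
    show "compact (colorful_simplex d w)" for w :: "nat \<Rightarrow> real ^ 'd"
      unfolding colorful_simplex_def by (intro finite_imp_compact_convex_hull) auto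
    show "\<exists>p. ?N \<le> real (card {w \<in> colorful_tuples d P. \<exists>y\<in>colorful_simplex d w. dist p y \<le> e})"
      if "e > 0" for e
      using exists_approximately_deep_point[OF dim assms(3) assms(4-6)[unfolded d] that]
      by (simp only: d Suc_eq_plus1)
  qed
  then show ?thesis unfolding num_colorful_simplices_containing_def .
qed

end
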